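(* Let $p_t^{(1)},p_t^{(2)}$ be the marginal densities of two (perfect) diffusion models with the same forward SDE coefficients, $\mathrm{d}X_t=f_t(X_t)\mathrm{d}t+\sigma_t\overrightarrow{\mathrm{d}W_t}$ (and different initial laws), and let $\beta\in\mathbb{R}$. In the classifier-free-guidance weight $w_{[\tau,\tau']}=[R^{\nu^{(1)}}_{\mu^{(1)}}(X_{[\tau,\tau']})]^{1-\beta}[R^{\nu^{(2)}}_{\mu^{(2)}}(X_{[\tau,\tau']})]^\beta[R^a_b(X_{[\tau,\tau']})]^{-1}$ (for targets $q_t\propto(p_t^{(1)})^{1-\beta}(p_t^{(2)})^\beta$) choose $$a_t=f_t-\sigma_t^2\big((1-\beta)\nabla\log p_t^{(1)}+\beta\nabla\log p_t^{(2)}\big),\qquad b_t=f_t,\qquad\epsilon_t=\sigma_t.$$ Then this is equivalent to the CFG Feynman–Kac corrector: the sampling process is the backward SDE $$\mathrm{d}X_t=\big(f_t(X_t)-(1-\beta)\sigma_t^2\nabla\log p_t^{(1)}(X_t)-\beta\sigma_t^2\nabla\log p_t^{(2)}(X_t)\big)\mathrm{d}t+\sigma_t\overleftarrow{\mathrm{d}W_t},$$ and along it $w_t:=w_{[t,\tau']}(X_{[t,\tau']})$ satisfies the backward ODE $$\mathrm{d}\log w_t=-\frac{\sigma_t^2}{2}\beta(\beta-1)\|\nabla\log p_t^{(1)}(X_t)-\nabla\log p_t^{(2)}(X_t)\|^2\,\mathrm{d}t.$$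
   Context: Notation. $\overrightarrow{\mathrm{d}\cdot}$: forward It\^o SDE/integral (left-endpoint evaluation). $\overleftarrow{\mathrm{d}\cdot}$: backward SDE/integral, run from the later time $\tau'$ downwards (right-endpoint evaluation). The ODE for $\log w_t$ is in the variable $t$, solved backwards from $\log w_{\tau'}=0$, i.e. $\log w_\tau=-\int_\tau^{\tau'}(\cdots)\mathrm{d}t$ with $(\cdots)$ the right-hand side coefficient. Time-reversal pairs with marginals $p_t^{(i)}$ and diffusion coefficient $\epsilon_t=\sigma_t$: $\mu^{(i)}_t=f_t$ (forward), $\nu^{(i)}_t=f_t-\sigma_t^2\nabla\log p^{(i)}_t$ (backward), $i=1,2$. For a forward drift $\mu$ and backward drift $\nu$ with diffusion coefficient $\epsilon_t$: $$R^\nu_\mu(X_{[\tau,\tau']})=\exp\Big(\int_\tau^{\tau'}\tfrac1{\epsilon_t^2}\nu_t\cdot\overleftarrow{\mathrm{d}X_t}-\int_\tau^{\tau'}\tfrac1{\epsilon_t^2}\mu_t\cdot\overrightarrow{\mathrm{d}X_t}+\tfrac12\int_\tau^{\tau'}\tfrac1{\epsilon_t^2}(\|\mu_t\|^2-\|\nu_t\|^2)\mathrm{d}t\Big),$$ drifts evaluated along $X_t$; $R^a_b$ is the same with backward drift $a$ and forward drift $b$. The weight $w_{[\tau,\tau']}$ equals, up to a path-independent constant, $\mathrm{d}\overrightarrow{\mathbb Q}^b/\mathrm{d}\overleftarrow{\mathbb Q}^a$, where $\overleftarrow{\mathbb Q}^a$ is the law of the backward SDE with drift $a$ started from $q_{\tau'}$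 and $\overrightarrow{\mathbb Q}^b$ the law of the forward SDE with drift $b$ started from $q_\tau$. $f_t$, $\log p^{(i)}_t$ and $\sigma_t>0$ are assumed sufficiently smooth. *)

theory Defs
  imports "HOL-Probability.Probability"
begin

section \<open>Forward and backward stochastic integrals\<close>

text \<open>
  Stochastic integrals over \<open>[s, t]\<close> are limits in probability, as the mesh of the partition
  \<open>s = \<pi> 0 \<le> \<dots> \<le> \<pi> n = t\<close> tends to zero, of left-endpoint (forward) or right-endpoint
  (backward) sums. This covers the continuous integrands occurring in the Radon-Nikodym
  ratio below.
\<close>

definition partition_of :: "real \<Rightarrow> real \<Rightarrow> real \<Rightarrow> nat \<Rightarrow> (nat \<Rightarrow> real) \<Rightarrow> bool" where
  "partition_of \<delta> s t n \<pi> \<longleftrightarrow>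
     \<pi> 0 = s \<and> \<pi> n = t \<and> (\<forall>k<n. \<pi> k \<le> \<pi> (Suc k) \<and> \<pi> (Suc k) - \<pi> k < \<delta>)"

definition mesh_limit_in_prob ::
  "'w measure \<Rightarrow> (nat \<Rightarrow> (nat \<Rightarrow> real) \<Rightarrow> 'w \<Rightarrow> 'c::real_normed_vector) \<Rightarrow> real \<Rightarrow> real \<Rightarrow>
   ('w \<Rightarrow> 'c) \<Rightarrow> bool" where
  "mesh_limit_in_prob M S s t I \<longleftrightarrow>
     I \<in> borel_measurable M \<and>
     (\<forall>e>0. \<forall>\<eta>>0. \<exists>\<delta>>0. \<forall>n \<pi>. partition_of \<delta> s t n \<pi> \<longrightarrow>
        measure M {\<omega> \<in> space M. norm (S n \<pi> \<omega> - I \<omega>) > e} < \<eta>)"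

text \<open>
  The operation \<open>op\<close> is the product between integrand and increment: the inner product for
  \<open>\<integral> g \<cdot> dY\<close>, scalar multiplication for \<open>\<integral> \<sigma> dW\<close>. Measurability is demanded explicitly because
  \<^const>\<open>measure\<close> vanishes on non-measurable sets.
\<close>

definition has_forward_integral ::
  "'w measure \<Rightarrow> ('b::topological_space \<Rightarrow> 'a::euclidean_space \<Rightarrow> 'c::real_normed_vector) \<Rightarrow>
   (real \<Rightarrow> 'w \<Rightarrow> 'b) \<Rightarrow> (real \<Rightarrow> 'w \<Rightarrow> 'a) \<Rightarrow> real \<Rightarrow> real \<Rightarrow> ('w \<Rightarrow> 'c) \<Rightarrow> bool" where
  "has_forward_integral M op g Y s t I \<longleftrightarrow>
     (\<forall>u\<in>{s..t}. g u \<in> borel_measurable M \<and> Y u \<in> borel_measurable M) \<and>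
     mesh_limit_in_prob M
       (\<lambda>n \<pi> \<omega>. \<Sum>k<n. op (g (\<pi> k) \<omega>) (Y (\<pi> (Suc k)) \<omega> - Y (\<pi> k) \<omega>)) s t I"

definition has_backward_integral ::
  "'w measure \<Rightarrow> ('b::topological_space \<Rightarrow> 'a::euclidean_space \<Rightarrow> 'c::real_normed_vector) \<Rightarrow>
   (real \<Rightarrow> 'w \<Rightarrow> 'b) \<Rightarrow> (real \<Rightarrow> 'w \<Rightarrow> 'a) \<Rightarrow> real \<Rightarrow> real \<Rightarrow> ('w \<Rightarrow> 'c) \<Rightarrow> bool" where
  "has_backward_integral M op g Y s t I \<longleftrightarrow>
     (\<forall>u\<in>{s..t}. g u \<in> borel_measurable M \<and> Y u \<in> borel_measurable M) \<and>
     mesh_limit_in_prob M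
       (\<lambda>n \<pi> \<omega>. \<Sum>k<n. op (g (\<pi> (Suc k)) \<omega>) (Y (\<pi> (Suc k)) \<omega> - Y (\<pi> k) \<omega>)) s t I"

text \<open>The integral, when it exists, is unique almost surely; a version is chosen.\<close>

definition forward_integral ::
  "'w measure \<Rightarrow> (real \<Rightarrow> 'w \<Rightarrow> 'a::euclidean_space) \<Rightarrow> (real \<Rightarrow> 'w \<Rightarrow> 'a) \<Rightarrow> real \<Rightarrow> real \<Rightarrow> 'w \<Rightarrow> real"
  where "forward_integral M g Y s t = (SOME I. has_forward_integral M (\<bullet>) g Y s t I)"

definition backward_integral ::
  "'w measure \<Rightarrow> (real \<Rightarrow> 'w \<Rightarrow> 'a::euclidean_space) \<Rightarrow> (real \<Rightarrow> 'w \<Rightarrow> 'a) \<Rightarrow> real \<Rightarrow> real \<Rightarrow> 'w \<Rightarrow> real"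
  where "backward_integral M g Y s t = (SOME I. has_backward_integral M (\<bullet>) g Y s t I)"


section \<open>Brownian motion and stochastic differential equations\<close>

definition gaussian_density :: "real \<Rightarrow> 'a::euclidean_space \<Rightarrow> real" where
  "gaussian_density v x = (\<Prod>e\<in>Basis. normal_density 0 (sqrt v) (x \<bullet> e))"

definition indep_of_algebra ::
  "'w measure \<Rightarrow> 'w measure \<Rightarrow> ('w \<Rightarrow> 'a::topological_space) \<Rightarrow> bool" where
  "indep_of_algebra M F Z \<longleftrightarrow>
     prob_space.indep_set M (sets F) {Z -` A \<inter> space M | A. A \<in> sets borel}"

definition forward_brownian ::
  "'w measure \<Rightarrow> (real \<Rightarrow> 'w measure) \<Rightarrow> real \<Rightarrow> real \<Rightarrow> (real \<Rightarrow> 'w \<Rightarrow> 'a::euclidean_space) \<Rightarrow> bool"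
  where
  "forward_brownian M F s t W \<longleftrightarrow>
     prob_space M \<and>
     (\<forall>u\<in>{s..t}. subalgebra M (F u) \<and> W u \<in> borel_measurable (F u)) \<and>
     (\<forall>u\<in>{s..t}. \<forall>v\<in>{u..t}. subalgebra (F v) (F u)) \<and>
     (\<forall>\<omega>\<in>space M. W s \<omega> = 0 \<and> continuous_on {s..t} (\<lambda>u. W u \<omega>)) \<and>
     (\<forall>u\<in>{s..t}. \<forall>v\<in>{u<..t}.
        distributed M lborel (\<lambda>\<omega>. W v \<omega> - W u \<omega>) (\<lambda>x. ennreal (gaussian_density (v - u) x)) \<and>
        indep_of_algebra M (F u) (\<lambda>\<omega>. W v \<omega> - W u \<omega>))"

text \<open>
  A backward Brownian motion runs from \<open>t\<close> down to \<open>s\<close> and is adapted to a family of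
  sigma-algebras that grows as time decreases. Only increments enter the equations, so
  normalising \<open>W\<close> to vanish at the starting time \<open>t\<close> is no restriction.
\<close>

definition backward_brownian ::
  "'w measure \<Rightarrow> (real \<Rightarrow> 'w measure) \<Rightarrow> real \<Rightarrow> real \<Rightarrow> (real \<Rightarrow> 'w \<Rightarrow> 'a::euclidean_space) \<Rightarrow> bool"
  where
  "backward_brownian M G s t W \<longleftrightarrow>
     prob_space M \<and>
     (\<forall>u\<in>{s..t}. subalgebra M (G u) \<and> W u \<in> borel_measurable (G u)) \<and>
     (\<forall>u\<in>{s..t}. \<forall>v\<in>{u..t}. subalgebra (G u) (G v)) \<and>
     (\<forall>\<omega>\<in>space M. W t \<omega> = 0 \<and> continuous_on {s..t} (\<lambda>u. W u \<omega>)) \<and>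
     (\<forall>u\<in>{s..t}. \<forall>v\<in>{u<..t}.
        distributed M lborel (\<lambda>\<omega>. W v \<omega> - W u \<omega>) (\<lambda>x. ennreal (gaussian_density (v - u) x)) \<and>
        indep_of_algebra M (G v) (\<lambda>\<omega>. W v \<omega> - W u \<omega>))"

definition forward_sde_solution ::
  "'w measure \<Rightarrow> (real \<Rightarrow> 'w measure) \<Rightarrow> (real \<Rightarrow> 'w \<Rightarrow> 'a::euclidean_space) \<Rightarrow>
   (real \<Rightarrow> 'a \<Rightarrow> 'a) \<Rightarrow> (real \<Rightarrow> real) \<Rightarrow> real \<Rightarrow> real \<Rightarrow> (real \<Rightarrow> 'w \<Rightarrow> 'a) \<Rightarrow> bool" where
  "forward_sde_solution M F W b \<sigma> s t X \<longleftrightarrow>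
     forward_brownian M F s t W \<and>
     (\<forall>u\<in>{s..t}. X u \<in> borel_measurable (F u)) \<and>
     (\<forall>\<omega>\<in>space M. continuous_on {s..t} (\<lambda>u. X u \<omega>)) \<and>
     (AE \<omega> in M. (\<lambda>r. b r (X r \<omega>)) absolutely_integrable_on {s..t}) \<and>
     (\<forall>u\<in>{s..t}. \<exists>I. has_forward_integral M (*\<^sub>R) (\<lambda>r _. \<sigma> r) W s u I \<and>
        (AE \<omega> in M. X u \<omega> = X s \<omega> + integral {s..u} (\<lambda>r. b r (X r \<omega>)) + I \<omega>))"

definition backward_sde_solution ::
  "'w measure \<Rightarrow> (real \<Rightarrow> 'w measure) \<Rightarrow> (real \<Rightarrow> 'w \<Rightarrow> 'a::euclidean_space) \<Rightarrow>
   (real \<Rightarrow> 'a \<Rightarrow> 'a) \<Rightarrow> (real \<Rightarrow> real) \<Rightarrow> real \<Rightarrow> real \<Rightarrow> (real \<Rightarrow> 'w \<Rightarrow> 'a) \<Rightarrow> bool" where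
  "backward_sde_solution M G W a \<sigma> s t X \<longleftrightarrow>
     backward_brownian M G s t W \<and>
     (\<forall>u\<in>{s..t}. X u \<in> borel_measurable (G u)) \<and>
     (\<forall>\<omega>\<in>space M. continuous_on {s..t} (\<lambda>u. X u \<omega>)) \<and>
     (AE \<omega> in M. (\<lambda>r. a r (X r \<omega>)) absolutely_integrable_on {s..t}) \<and>
     (\<forall>u\<in>{s..t}. \<exists>I. has_backward_integral M (*\<^sub>R) (\<lambda>r _. \<sigma> r) W u t I \<and>
        (AE \<omega> in M. X u \<omega> = X t \<omega> - integral {u..t} (\<lambda>r. a r (X r \<omega>)) - I \<omega>))"


section \<open>Diffusion models and the guidance weight\<close>

definition gradient :: "('a::real_inner \<Rightarrow> real) \<Rightarrow> 'a \<Rightarrow> 'a" where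
  "gradient g x = (THE D. GDERIV g x :> D)"

definition score :: "(real \<Rightarrow> 'a::real_inner \<Rightarrow> real) \<Rightarrow> real \<Rightarrow> 'a \<Rightarrow> 'a" where
  "score p t x = gradient (\<lambda>y. ln (p t y)) x"

text \<open>Backward drift of the time reversal of the forward equation with drift \<open>f\<close>.\<close>

definition reversal_drift ::
  "(real \<Rightarrow> 'a::real_inner \<Rightarrow> 'a) \<Rightarrow> (real \<Rightarrow> real) \<Rightarrow> (real \<Rightarrow> 'a \<Rightarrow> real) \<Rightarrow> real \<Rightarrow> 'a \<Rightarrow> 'a" where
  "reversal_drift f \<sigma> p t x = f t x - (\<sigma> t)\<^sup>2 *\<^sub>R score p t x"

text \<open>
  Regularity on \<open>[s, t]\<close>: the forward drift is continuous in time and continuously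
  differentiable in space, so that its forward integral along a backward diffusion makes sense;
  the scores are jointly continuous.
\<close>

definition smooth_drift :: "real \<Rightarrow> real \<Rightarrow> (real \<Rightarrow> 'a::euclidean_space \<Rightarrow> 'a) \<Rightarrow> bool" where
  "smooth_drift s t f \<longleftrightarrow>
     continuous_on ({s..t} \<times> UNIV) (\<lambda>(u, x). f u x) \<and>
     (\<exists>f' :: real \<Rightarrow> 'a \<Rightarrow> 'a \<Rightarrow>\<^sub>L 'a.
        (\<forall>u\<in>{s..t}. \<forall>x. (f u has_derivative blinfun_apply (f' u x)) (at x)) \<and>
        continuous_on ({s..t} \<times> UNIV) (\<lambda>(u, x). f' u x))"

definition smooth_log_density :: "real \<Rightarrow> real \<Rightarrow> (real \<Rightarrow> 'a::euclidean_space \<Rightarrow> real) \<Rightarrow> bool" where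
  "smooth_log_density s t p \<longleftrightarrow>
     (\<forall>u\<in>{s..t}. \<forall>x. 0 < p u x \<and> (\<lambda>y. ln (p u y)) differentiable (at x)) \<and>
     continuous_on ({s..t} \<times> UNIV) (\<lambda>(u, x). score p u x)"

text \<open>
  The ratio \<open>R\<^sup>\<nu>\<^sub>\<mu>\<close> for the path of \<open>X\<close> on \<open>[s, t]\<close>, with forward drift \<open>\<mu>\<close> and backward
  drift \<open>\<nu>\<close>.
\<close>

definition rn_ratio ::
  "'w measure \<Rightarrow> (real \<Rightarrow> real) \<Rightarrow> (real \<Rightarrow> 'a::euclidean_space \<Rightarrow> 'a) \<Rightarrow> (real \<Rightarrow> 'a \<Rightarrow> 'a) \<Rightarrow>
   (real \<Rightarrow> 'w \<Rightarrow> 'a) \<Rightarrow> real \<Rightarrow> real \<Rightarrow> 'w \<Rightarrow> real" where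
  "rn_ratio M \<epsilon> \<nu> \<mu> X s t \<omega> = exp (
      backward_integral M (\<lambda>u \<omega>. (1 / (\<epsilon> u)\<^sup>2) *\<^sub>R \<nu> u (X u \<omega>)) X s t \<omega>
    - forward_integral M (\<lambda>u \<omega>. (1 / (\<epsilon> u)\<^sup>2) *\<^sub>R \<mu> u (X u \<omega>)) X s t \<omega>
    + 1 / 2 * integral {s..t}
        (\<lambda>u. 1 / (\<epsilon> u)\<^sup>2 * ((norm (\<mu> u (X u \<omega>)))\<^sup>2 - (norm (\<nu> u (X u \<omega>)))\<^sup>2)))"

definition cfg_weight ::
  "'w measure \<Rightarrow> (real \<Rightarrow> real) \<Rightarrow> real \<Rightarrow>
   (real \<Rightarrow> 'a::euclidean_space \<Rightarrow> 'a) \<Rightarrow> (real \<Rightarrow> 'a \<Rightarrow> 'a) \<Rightarrow>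
   (real \<Rightarrow> 'a \<Rightarrow> 'a) \<Rightarrow> (real \<Rightarrow> 'a \<Rightarrow> 'a) \<Rightarrow>
   (real \<Rightarrow> 'a \<Rightarrow> 'a) \<Rightarrow> (real \<Rightarrow> 'a \<Rightarrow> 'a) \<Rightarrow>
   (real \<Rightarrow> 'w \<Rightarrow> 'a) \<Rightarrow> real \<Rightarrow> real \<Rightarrow> 'w \<Rightarrow> real" where
  "cfg_weight M \<epsilon> \<beta> \<nu>1 \<mu>1 \<nu>2 \<mu>2 a b X s t \<omega> =
     rn_ratio M \<epsilon> \<nu>1 \<mu>1 X s t \<omega> powr (1 - \<beta>)
   * rn_ratio M \<epsilon> \<nu>2 \<mu>2 X s t \<omega> powr \<beta>
   * inverse (rn_ratio M \<epsilon> a b X s t \<omega>)"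

definition cfg_target ::
  "(real \<Rightarrow> 'a::euclidean_space \<Rightarrow> real) \<Rightarrow> (real \<Rightarrow> 'a \<Rightarrow> real) \<Rightarrow> real \<Rightarrow> real \<Rightarrow> 'a \<Rightarrow> real" where
  "cfg_target p1 p2 \<beta> t x =
     p1 t x powr (1 - \<beta>) * p2 t x powr \<beta> / (LINT y|lborel. p1 t y powr (1 - \<beta>) * p2 t y powr \<beta>)"

end

theory Submission
  imports Defs
begin

text \<open>
  Since \<open>b = f\<close>, the forward integrals of the three ratios are the same random variable, with total
  coefficient \<open>(1 - \<beta>) + \<beta> - 1 = 0\<close>. Since \<open>a = (1 - \<beta>) \<nu>\<^sup>1 + \<beta> \<nu>\<^sup>2\<close>, the backward integrals
  cancel almost surely by linearity, and the Lebesgue integrals combine to the asserted quadratic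
  expression in the difference of the scores.

  As the integrals are chosen versions of limits in probability, linearity requires that the limits
  exist. The difference of the Riemann sums over two partitions is a sum over the cells of their
  common refinement. On an event of probability close to one the integrand and the drift are bounded.
  There the drift contributes little by \<open>L\<^sup>1\<close>-uniform continuity of the truncated integrand, and
  the noise contributes little by Chebyshev's inequality and orthogonality of Wiener increments.
  Hence the Riemann sums are Cauchy in probability.
\<close>

section \<open>Moments of backward Wiener sums\<close>

text \<open>Right-endpoint sums are the non-anticipating ones here: \<open>G\<close> grows as time
  decreases, and the increment of \<open>W\<close> over \<open>{u..v}\<close> is independent of
  \<open>G v\<close>. When two partitions are compared, each nondegenerate cell of the refinement
  carries a difference of the integrand at two times not before its right end, hence something known
  there; this makes the noise terms orthogonal. Two obstacles shape the estimate. No moments of the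
  drift or the integrand are available, so both are controlled on a large event only, and the
  integrand is replaced by a radial truncation, which keeps adaptedness and continuity without
  stopping times. The noise of \<open>X\<close> is itself known only as a limit in probability of
  sums in \<open>W\<close>, so second moments are computed for those sums and carried to the limit
  as tail bounds. Finally, the chosen versions of the integrals determine \<open>ln (w t)\<close>
  only off a null set that may depend on \<open>t\<close>; the differential equation is therefore
  asserted for a version \<open>L\<close>, given by the explicit time integral.\<close>

text \<open>Independence is given between \<open>F\<close> and the preimages under \<open>Z\<close>,
  whereas the product rule for expectations needs it for the sigma-algebras generated by the two
  real variables. The one of \<open>Y\<close> lies in \<open>F\<close>, the other in the preimages
  under \<open>Z\<close>, and independence passes to smaller families.\<close>

lemma indep_of_algebra_expectation:
  fixes Y :: "'w \<Rightarrow> real" and Z :: "'w \<Rightarrow> 'b::euclidean_space"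
  assumes "prob_space M" and sub: "subalgebra M F" and ind: "indep_of_algebra M F Z"
    and Z: "Z \<in> borel_measurable M" and Y: "Y \<in> borel_measurable F"
    and \<phi>: "\<phi> \<in> borel_measurable borel"
    and int: "integrable M Y" "integrable M (\<lambda>\<omega>. \<phi> (Z \<omega>))"
  shows "integrable M (\<lambda>\<omega>. Y \<omega> * \<phi> (Z \<omega>))"
    and "(\<integral>\<omega>. Y \<omega> * \<phi> (Z \<omega>) \<partial>M) = (\<integral>\<omega>. Y \<omega> \<partial>M) * (\<integral>\<omega>. (\<phi> (Z \<omega>) :: real) \<partial>M)"
proof -
  interpret prob_space M by fact
  let ?V = "vimage_algebra (space M) Z borel"
  have V: "sets ?V = {Z -` A \<inter> space M | A. A \<in> sets borel}"
    by (rule sets_vimage_algebra2) auto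
  have sp: "space F = space M"
    using sub by (simp add: subalgebra_def)
  have YM: "Y \<in> borel_measurable M"
    using measurable_from_subalg[OF sub Y] .
  have "{Y -` A \<inter> space M | A. A \<in> sets borel} \<subseteq> sets F"
    using measurable_sets[OF Y] by (auto simp: sp)
  from sets.sigma_sets_subset[OF this]
  have "sigma_sets (space M) {Y -` A \<inter> space M | A. A \<in> sets borel} \<subseteq> sets F"
    by (simp add: sp)
  moreover have "sigma_sets (space M) {(\<lambda>\<omega>. \<phi> (Z \<omega>)) -` A \<inter> space M | A. A \<in> sets borel} \<subseteq> sets ?V"
  proof -
    have "{(\<lambda>\<omega>. \<phi> (Z \<omega>)) -` A \<inter> space M | A. A \<in> sets borel} \<subseteq> sets ?V"
    proof safe
      fix A :: "real set" assume "A \<in> sets borel"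
      then have "\<phi> -` A \<in> sets borel"
        using measurable_sets[OF \<phi>] by simp
      then show "(\<lambda>\<omega>. \<phi> (Z \<omega>)) -` A \<inter> space M \<in> sets ?V"
        unfolding V by (auto intro!: exI[of _ "\<phi> -` A"])
    qed
    from sets.sigma_sets_subset[OF this] show ?thesis by simp
  qed
  ultimately have "indep_set (sigma_sets (space M) {Y -` A \<inter> space M | A. A \<in> sets borel})
     (sigma_sets (space M) {(\<lambda>\<omega>. \<phi> (Z \<omega>)) -` A \<inter> space M | A. A \<in> sets borel})"
    using ind unfolding indep_of_algebra_def V indep_set_def
    by (elim indep_sets_mono_sets) (auto split: bool.split)
  then have "indep_var borel Y borel (\<lambda>\<omega>. \<phi> (Z \<omega>))"
    unfolding indep_var_eq using YM Z \<phi> by auto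
  then show "integrable M (\<lambda>\<omega>. Y \<omega> * \<phi> (Z \<omega>))"
    and "(\<integral>\<omega>. Y \<omega> * \<phi> (Z \<omega>) \<partial>M) = (\<integral>\<omega>. Y \<omega> \<partial>M) * (\<integral>\<omega>. (\<phi> (Z \<omega>) :: real) \<partial>M)"
    using int by (auto intro: indep_var_integrable indep_var_lebesgue_integral)
qed

section \<open>Gaussian moments, coordinate by coordinate\<close>

text \<open>Lebesgue measure on a Euclidean space is the image of a product of one-dimensional
  copies under the coordinate map, so Fubini for finite products of measures applies.\<close>

lemma has_bochner_integral_lborel_prod:
  fixes g :: "'a::euclidean_space \<Rightarrow> real \<Rightarrow> real"
  assumes "\<And>b. b \<in> Basis \<Longrightarrow> integrable lborel (g b)"
  shows "has_bochner_integral lborel (\<lambda>x::'a. \<Prod>b\<in>Basis. g b (x \<bullet> b)) (\<Prod>b\<in>Basis. \<integral>x. g b x \<partial>lborel)"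
proof -
  interpret product_sigma_finite "\<lambda>_::'a. lborel :: real measure"
    by standard
  let ?P = "\<Pi>\<^sub>M b\<in>(Basis::'a set). (lborel :: real measure)"
  let ?T = "\<lambda>f. \<Sum>b\<in>Basis. f b *\<^sub>R (b::'a)"
  have T: "?T \<in> measurable ?P borel" by measurable
  have [measurable]: "(\<lambda>x::'a. \<Prod>b\<in>Basis. g b (x \<bullet> b)) \<in> borel_measurable borel"
  proof (rule borel_measurable_prod)
    fix b :: 'a assume "b \<in> Basis"
    then have [measurable]: "g b \<in> borel_measurable borel"
      using borel_measurable_integrable[OF assms] by simp
    show "(\<lambda>x::'a. g b (x \<bullet> b)) \<in> borel_measurable borel" by measurable
  qed
  have eq: "(\<Prod>b\<in>Basis. g b (?T f \<bullet> b)) = (\<Prod>b\<in>Basis. g b (f b))" for f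
    by (intro prod.cong refl) simp
  have "integrable lborel (\<lambda>x::'a. \<Prod>b\<in>Basis. g b (x \<bullet> b))"
  proof (unfold lborel_eq[where 'a='a], subst integrable_distr_eq[OF T])
    show "integrable ?P (\<lambda>f. \<Prod>b\<in>Basis. g b (?T f \<bullet> b))"
      unfolding eq by (rule product_integrable_prod) (auto intro: assms)
  qed measurable
  moreover have "integral\<^sup>L lborel (\<lambda>x::'a. \<Prod>b\<in>Basis. g b (x \<bullet> b)) = (\<Prod>b\<in>Basis. \<integral>x. g b x \<partial>lborel)"
  proof (unfold lborel_eq[where 'a='a], subst integral_distr[OF T])
    show "(\<integral>f. (\<Prod>b\<in>Basis. g b (?T f \<bullet> b)) \<partial>?P) = (\<Prod>b\<in>Basis. \<integral>x. g b x \<partial>lborel)"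
      unfolding eq by (rule product_integral_prod) (auto intro: assms)
  qed measurable
  ultimately show ?thesis
    by (simp add: has_bochner_integral_iff)
qed

lemma gaussian_density_integral:
  fixes e :: "'a::euclidean_space"
  assumes "0 < v" and e: "e \<in> Basis" and h: "integrable lborel (\<lambda>x. normal_density 0 (sqrt v) x * h x)"
  shows "has_bochner_integral lborel (\<lambda>x::'a. gaussian_density v x * h (x \<bullet> e))
           (\<integral>x. normal_density 0 (sqrt v) x * h x \<partial>lborel)"
proof -
  \<comment> \<open>The test function sits in the factor of \<open>e\<close>; every other factor is
    a one-dimensional normal density and integrates to 1.\<close>
  define g where "g b x = normal_density 0 (sqrt v) x * (if b = e then h x else 1)" for b :: 'a and x
  have "integrable lborel (g b)" if "b \<in> Basis" for b
    using h integrable_normal_density[of "sqrt v" 0] \<open>0 < v\<close> by (cases "b = e") (auto simp: g_def[abs_def])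
  from has_bochner_integral_lborel_prod[OF this]
  have "has_bochner_integral lborel (\<lambda>x::'a. \<Prod>b\<in>Basis. g b (x \<bullet> b)) (\<Prod>b\<in>Basis. \<integral>x. g b x \<partial>lborel)" .
  moreover have "(\<Prod>b\<in>Basis. g b (x \<bullet> b)) = gaussian_density v x * h (x \<bullet> e)" for x :: 'a
    using e by (simp add: g_def gaussian_density_def prod.distrib)
  moreover have "(\<integral>x. g b x \<partial>lborel) = (if b = e then (\<integral>x. normal_density 0 (sqrt v) x * h x \<partial>lborel) else 1)" for b
    using \<open>0 < v\<close> by (simp add: g_def)
  ultimately show ?thesis
    using e by simp
qed

lemma gaussian_density_nonneg: "0 < v \<Longrightarrow> 0 \<le> gaussian_density v x"
  by (simp add: gaussian_density_def prod_nonneg)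

lemma distributed_gaussian_moments:
  fixes Z :: "'w \<Rightarrow> 'a::euclidean_space"
  assumes v: "0 < v" and dist: "distributed M lborel Z (\<lambda>x. ennreal (gaussian_density v x))"
    and e: "e \<in> Basis"
  shows "has_bochner_integral M (\<lambda>\<omega>. Z \<omega> \<bullet> e) 0"
    and "has_bochner_integral M (\<lambda>\<omega>. (Z \<omega> \<bullet> e)\<^sup>2) v"
proof -
  have *: "has_bochner_integral M (\<lambda>\<omega>. h (Z \<omega> \<bullet> e)) c"
    if [measurable]: "h \<in> borel_measurable borel"
      and "has_bochner_integral lborel (\<lambda>x. normal_density 0 (sqrt v) x * h x) c" for h :: "real \<Rightarrow> real" and c
  proof -
    have "has_bochner_integral lborel (\<lambda>x::'a. gaussian_density v x * h (x \<bullet> e)) c"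
      using gaussian_density_integral[OF v e, of h] that by (auto simp: has_bochner_integral_iff)
    then show ?thesis
      using distributed_integrable[OF dist, of "\<lambda>x. h (x \<bullet> e)"] distributed_integral[OF dist, of "\<lambda>x. h (x \<bullet> e)"]
      by (simp add: has_bochner_integral_iff gaussian_density_nonneg[OF v])
  qed
  show "has_bochner_integral M (\<lambda>\<omega>. Z \<omega> \<bullet> e) 0"
    using *[of "\<lambda>x. x" 0] normal_moment_odd[of "sqrt v" 0 0] v by simp
  \<comment> \<open>The even moment formula at index 1 reads 2! / (2 / v) = v, the standard
    deviation being \<open>sqrt v\<close>.\<close>
  show "has_bochner_integral M (\<lambda>\<omega>. (Z \<omega> \<bullet> e)\<^sup>2) v"
    using *[of "\<lambda>x. x\<^sup>2" v] normal_moment_even[of "sqrt v" 0 1] v by simp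
qed

section \<open>Weighted Wiener increments\<close>

text \<open>For a backward Brownian motion the increment over \<open>{u..v}\<close> is independent
  of the information at its right end, where \<open>Z\<close> is known. The independence rule is
  scalar, so the inner product is expanded in coordinates; the squared norms factor directly, and
  each coordinate contributes variance \<open>v - u\<close>, whence the dimension.\<close>

lemma backward_brownian_increment:
  fixes W :: "real \<Rightarrow> 'w \<Rightarrow> 'a::euclidean_space" and u v :: real
  assumes bb: "backward_brownian M G s t W" and uv: "s \<le> u" "u \<le> v" "v \<le> t"
    and Z: "Z \<in> borel_measurable (G v)"
  shows "integrable M (\<lambda>\<omega>. norm (Z \<omega>)) \<Longrightarrow> has_bochner_integral M (\<lambda>\<omega>. Z \<omega> \<bullet> (W v \<omega> - W u \<omega>)) 0"
    and "integrable M (\<lambda>\<omega>. (norm (Z \<omega>))\<^sup>2) \<Longrightarrow>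
      has_bochner_integral M (\<lambda>\<omega>. (norm (Z \<omega>))\<^sup>2 * (norm (W v \<omega> - W u \<omega>))\<^sup>2)
        (DIM('a) * (v - u) * (\<integral>\<omega>. (norm (Z \<omega>))\<^sup>2 \<partial>M))"
proof -
  let ?D = "\<lambda>\<omega>. W v \<omega> - W u \<omega>"
  have ps: "prob_space M" and sub: "subalgebra M (G v)"
    using bb uv by (auto simp: backward_brownian_def)
  have ZM: "Z \<in> borel_measurable M"
    using measurable_from_subalg[OF sub Z] .
  show 1: "has_bochner_integral M (\<lambda>\<omega>. Z \<omega> \<bullet> ?D \<omega>) 0" if int: "integrable M (\<lambda>\<omega>. norm (Z \<omega>))"
  \<comment> \<open>The law of the increment is prescribed only for \<open>u < v\<close>; for
    \<open>u = v\<close> the increment is 0.\<close>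
  proof (cases "u < v")
    case True
    then have dist: "distributed M lborel ?D (\<lambda>x. ennreal (gaussian_density (v - u) x))"
      and ind: "indep_of_algebra M (G v) ?D"
      using bb uv by (auto simp: backward_brownian_def)
    have D: "?D \<in> borel_measurable M"
      using distributed_measurable[OF dist] by simp
    have "has_bochner_integral M (\<lambda>\<omega>. \<Sum>e\<in>Basis. (Z \<omega> \<bullet> e) * (?D \<omega> \<bullet> e)) (\<Sum>e\<in>(Basis::'a set). 0)"
    proof (rule has_bochner_integral_sum)
      fix e :: 'a assume e: "e \<in> Basis"
      have m: "has_bochner_integral M (\<lambda>\<omega>. ?D \<omega> \<bullet> e) 0"
        using distributed_gaussian_moments(1)[OF _ dist e] True by simp
      have "integrable M (\<lambda>\<omega>. Z \<omega> \<bullet> e)"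
        by (rule Bochner_Integration.integrable_bound[OF int]) (use ZM e Basis_le_norm in auto)
      then show "has_bochner_integral M (\<lambda>\<omega>. (Z \<omega> \<bullet> e) * (?D \<omega> \<bullet> e)) 0"
        using indep_of_algebra_expectation[OF ps sub ind D, of "\<lambda>\<omega>. Z \<omega> \<bullet> e" "\<lambda>x. x \<bullet> e"] m Z
        by (auto simp: has_bochner_integral_iff)
    qed
    then show ?thesis
      by (simp flip: euclidean_inner)
  qed (use uv in \<open>simp add: has_bochner_integral_zero\<close>)
  show "has_bochner_integral M (\<lambda>\<omega>. (norm (Z \<omega>))\<^sup>2 * (norm (?D \<omega>))\<^sup>2)
        (DIM('a) * (v - u) * (\<integral>\<omega>. (norm (Z \<omega>))\<^sup>2 \<partial>M))" if int: "integrable M (\<lambda>\<omega>. (norm (Z \<omega>))\<^sup>2)"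
  proof (cases "u < v")
    case True
    then have dist: "distributed M lborel ?D (\<lambda>x. ennreal (gaussian_density (v - u) x))"
      and ind: "indep_of_algebra M (G v) ?D"
      using bb uv by (auto simp: backward_brownian_def)
    have D: "?D \<in> borel_measurable M"
      using distributed_measurable[OF dist] by simp
    have "has_bochner_integral M (\<lambda>\<omega>. \<Sum>e\<in>Basis. (?D \<omega> \<bullet> e)\<^sup>2) (\<Sum>e\<in>(Basis::'a set). v - u)"
      using distributed_gaussian_moments(2)[OF _ dist] True by (intro has_bochner_integral_sum) auto
    then have "has_bochner_integral M (\<lambda>\<omega>. (norm (?D \<omega>))\<^sup>2) (DIM('a) * (v - u))"
      unfolding power2_norm_eq_inner by (subst euclidean_inner) (simp add: power2_eq_square)
    then show ?thesis
      using indep_of_algebra_expectation[OF ps sub ind D, of "\<lambda>\<omega>. (norm (Z \<omega>))\<^sup>2" "\<lambda>x. (norm x)\<^sup>2"] int Z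
      by (auto simp: has_bochner_integral_iff)
  qed (use uv in \<open>simp add: has_bochner_integral_zero\<close>)
qed

text \<open>Increments over disjoint intervals are orthogonal, because the integrand and the increment of
  the later interval are measurable with respect to the information at the right end of the earlier one.\<close>

lemma backward_brownian_second_moment:
  fixes W :: "real \<Rightarrow> 'w \<Rightarrow> 'a::euclidean_space" and u v :: "'i \<Rightarrow> real"
  assumes bb: "backward_brownian M G s t W" and "finite A"
    and uv: "\<And>i. i \<in> A \<Longrightarrow> s \<le> u i \<and> u i \<le> v i \<and> v i \<le> t"
    and disj: "\<And>i j. i \<in> A \<Longrightarrow> j \<in> A \<Longrightarrow> i \<noteq> j \<Longrightarrow> v i \<le> u j \<or> v j \<le> u i"
    and H: "\<And>i. i \<in> A \<Longrightarrow> H i \<in> borel_measurable (G (v i))"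
    and bd: "\<And>i \<omega>. i \<in> A \<Longrightarrow> \<omega> \<in> space M \<Longrightarrow> norm (H i \<omega>) \<le> K"
  shows "integrable M (\<lambda>\<omega>. (\<Sum>i\<in>A. H i \<omega> \<bullet> (W (v i) \<omega> - W (u i) \<omega>))\<^sup>2)"
    and "(\<integral>\<omega>. (\<Sum>i\<in>A. H i \<omega> \<bullet> (W (v i) \<omega> - W (u i) \<omega>))\<^sup>2 \<partial>M)
       \<le> DIM('a) * (\<Sum>i\<in>A. (v i - u i) * (\<integral>\<omega>. (norm (H i \<omega>))\<^sup>2 \<partial>M))"
proof -
  define E where "E i \<omega> = H i \<omega> \<bullet> (W (v i) \<omega> - W (u i) \<omega>)" for i \<omega>
  interpret prob_space M using bb by (simp add: backward_brownian_def)
  have sub: "subalgebra M (G x)" if "s \<le> x" "x \<le> t" for x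
    using bb that by (auto simp: backward_brownian_def)
  have sub2: "subalgebra (G x) (G y)" if "s \<le> x" "x \<le> y" "y \<le> t" for x y
    using bb that by (auto simp: backward_brownian_def)
  have W: "W x \<in> borel_measurable (G x)" if "s \<le> x" "x \<le> t" for x
    using bb that by (auto simp: backward_brownian_def)
  have WM: "W x \<in> borel_measurable M" if "s \<le> x" "x \<le> t" for x
    using measurable_from_subalg[OF sub W] that by blast
  have HM: "H i \<in> borel_measurable M" if "i \<in> A" for i
    using measurable_from_subalg[OF sub H] uv that by force
  have intH: "integrable M (\<lambda>\<omega>. norm (H i \<omega>))" if "i \<in> A" for i
    by (rule integrable_const_bound[where B = K]) (use bd HM that in auto)
  have intH2: "integrable M (\<lambda>\<omega>. (norm (H i \<omega>))\<^sup>2)" if "i \<in> A" for i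
    by (rule integrable_const_bound[where B = "K\<^sup>2"]) (use bd HM that in \<open>auto intro!: power_mono\<close>)
  have EM: "E i \<in> borel_measurable M" if "i \<in> A" for i
    unfolding E_def using HM WM[of "u i"] WM[of "v i"] uv[OF that] that
    by (auto intro!: borel_measurable_inner borel_measurable_diff)
  have sq: "has_bochner_integral M (\<lambda>\<omega>. (norm (H i \<omega>))\<^sup>2 * (norm (W (v i) \<omega> - W (u i) \<omega>))\<^sup>2)
        (DIM('a) * (v i - u i) * (\<integral>\<omega>. (norm (H i \<omega>))\<^sup>2 \<partial>M))" if "i \<in> A" for i
    using backward_brownian_increment(2)[OF bb _ _ _ H[OF that] intH2[OF that]] uv that by blast
  \<comment> \<open>Cauchy-Schwarz is the origin of the factor \<open>DIM('a)\<close> in the bound: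
    it costs a dimensional constant but spares mixed moments of the coordinates.\<close>
  have le: "(E i \<omega>)\<^sup>2 \<le> (norm (H i \<omega>))\<^sup>2 * (norm (W (v i) \<omega> - W (u i) \<omega>))\<^sup>2" for i \<omega>
    unfolding E_def by (metis Cauchy_Schwarz_ineq power2_norm_eq_inner)
  have intE2: "integrable M (\<lambda>\<omega>. (E i \<omega>)\<^sup>2)" if "i \<in> A" for i
    by (rule Bochner_Integration.integrable_bound[OF has_bochner_integral_iff[THEN iffD1, OF sq[OF that], THEN conjunct1]])
      (use EM that le in auto)
  have E2: "(\<integral>\<omega>. (E i \<omega>)\<^sup>2 \<partial>M) \<le> DIM('a) * ((v i - u i) * (\<integral>\<omega>. (norm (H i \<omega>))\<^sup>2 \<partial>M))" if "i \<in> A" for i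
    using integral_mono[OF intE2[OF that] _ le] sq[OF that] by (auto simp: has_bochner_integral_iff mult.assoc)
  have intEE: "integrable M (\<lambda>\<omega>. E i \<omega> * E j \<omega>)" if "i \<in> A" "j \<in> A" for i j
  proof (rule Bochner_Integration.integrable_bound)
    show "integrable M (\<lambda>\<omega>. (E i \<omega>)\<^sup>2 + (E j \<omega>)\<^sup>2)"
      using intE2 that by auto
    have "\<bar>x * y\<bar> \<le> x\<^sup>2 + y\<^sup>2" for x y :: real
    proof -
      have "0 \<le> \<bar>x\<bar> * \<bar>y\<bar>" by simp
      with sum_squares_bound[of "\<bar>x\<bar>" "\<bar>y\<bar>"] show ?thesis
        unfolding abs_mult power2_abs by linarith
    qed
    then show "AE \<omega> in M. norm (E i \<omega> * E j \<omega>) \<le> norm ((E i \<omega>)\<^sup>2 + (E j \<omega>)\<^sup>2)"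
      by auto
  qed (use EM that in auto)
  \<comment> \<open>Interval \<open>j\<close> lies to the right of interval \<open>i\<close>, so
    \<open>E j\<close> and \<open>H i\<close> are both known at \<open>v i\<close>. Their product is
    thus an admissible weight for the increment over interval \<open>i\<close>, and the weighted
    increment has mean zero.\<close>
  have cross: "(\<integral>\<omega>. E i \<omega> * E j \<omega> \<partial>M) = 0" if "i \<in> A" "j \<in> A" "v i \<le> u j" for i j
  proof -
    have uvj: "s \<le> u j" "u j \<le> v j" "v j \<le> t"
      using uv that by auto
    from measurable_from_subalg[OF sub2[OF this]]
    have "H j \<in> borel_measurable (G (u j))" "W (v j) \<in> borel_measurable (G (u j))"
      using H[OF that(2)] W[of "v j"] uvj by auto
    moreover have "W (u j) \<in> borel_measurable (G (u j))"
      using W[of "u j"] uvj by auto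
    ultimately have "E j \<in> borel_measurable (G (u j))"
      unfolding E_def by (auto intro!: borel_measurable_inner borel_measurable_diff)
    moreover have "s \<le> v i" "u j \<le> t"
      using uv[OF that(1)] uvj by auto
    ultimately have Ej: "E j \<in> borel_measurable (G (v i))"
      using measurable_from_subalg[OF sub2[of "v i" "u j"]] that(3) by blast
    have intEj: "integrable M (E j)"
      by (rule square_integrable_imp_integrable[OF EM[OF that(2)] intE2[OF that(2)]])
    have "integrable M (\<lambda>\<omega>. norm (E j \<omega> *\<^sub>R H i \<omega>))"
    proof (rule Bochner_Integration.integrable_bound)
      show "integrable M (\<lambda>\<omega>. K * E j \<omega>)"
        using intEj by simp
      show "AE \<omega> in M. norm (norm (E j \<omega> *\<^sub>R H i \<omega>)) \<le> norm (K * E j \<omega>)"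
      proof (rule AE_I2)
        fix \<omega> assume "\<omega> \<in> space M"
        from bd[OF that(1) this] have "norm (H i \<omega>) \<le> \<bar>K\<bar>" by linarith
        then show "norm (norm (E j \<omega> *\<^sub>R H i \<omega>)) \<le> norm (K * E j \<omega>)"
          by (simp add: abs_mult mult.commute[of "\<bar>K\<bar>"] mult_left_mono)
      qed
    qed (use EM HM that in auto)
    from backward_brownian_increment(1)[OF bb _ _ _ _ this, of "u i" "v i"] uv[OF that(1)] Ej H[OF that(1)]
    have "has_bochner_integral M (\<lambda>\<omega>. (E j \<omega> *\<^sub>R H i \<omega>) \<bullet> (W (v i) \<omega> - W (u i) \<omega>)) 0"
      by auto
    then show ?thesis
      by (simp add: has_bochner_integral_iff E_def mult.commute)
  qed
  have diag: "(\<integral>\<omega>. E i \<omega> * E j \<omega> \<partial>M) = (if i = j then (\<integral>\<omega>. (E i \<omega>)\<^sup>2 \<partial>M) else 0)" if "i \<in> A" "j \<in> A" for i j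
    using cross[of i j] cross[of j i] disj[of i j] that by (auto simp: power2_eq_square mult.commute)
  have exp: "(\<Sum>i\<in>A. E i \<omega>)\<^sup>2 = (\<Sum>i\<in>A. \<Sum>j\<in>A. E i \<omega> * E j \<omega>)" for \<omega>
    by (simp add: power2_eq_square sum_product)
  show "integrable M (\<lambda>\<omega>. (\<Sum>i\<in>A. H i \<omega> \<bullet> (W (v i) \<omega> - W (u i) \<omega>))\<^sup>2)"
    unfolding E_def[symmetric] exp by (auto intro!: Bochner_Integration.integrable_sum intEE)
  have "(\<integral>\<omega>. (\<Sum>i\<in>A. E i \<omega>)\<^sup>2 \<partial>M) = (\<Sum>i\<in>A. \<Sum>j\<in>A. (\<integral>\<omega>. E i \<omega> * E j \<omega> \<partial>M))"
    unfolding exp by (simp add: intEE Bochner_Integration.integrable_sum)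
  also have "\<dots> = (\<Sum>i\<in>A. (\<integral>\<omega>. (E i \<omega>)\<^sup>2 \<partial>M))"
    using \<open>finite A\<close> by (simp add: diag)
  also have "\<dots> \<le> DIM('a) * (\<Sum>i\<in>A. (v i - u i) * (\<integral>\<omega>. (norm (H i \<omega>))\<^sup>2 \<partial>M))"
    unfolding sum_distrib_left using E2 by (rule sum_mono)
  finally show "(\<integral>\<omega>. (\<Sum>i\<in>A. H i \<omega> \<bullet> (W (v i) \<omega> - W (u i) \<omega>))\<^sup>2 \<partial>M)
       \<le> DIM('a) * (\<Sum>i\<in>A. (v i - u i) * (\<integral>\<omega>. (norm (H i \<omega>))\<^sup>2 \<partial>M))"
    unfolding E_def .
qed

section \<open>Limits along partitions\<close>

lemma partition_of_mono:
  assumes "partition_of \<delta> s t n \<pi>" "k \<le> l" "l \<le> n"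
  shows "\<pi> k \<le> \<pi> l"
  using assms(2,3)
proof (induction l)
  case (Suc l)
  then have "\<pi> l \<le> \<pi> (Suc l)"
    using assms(1) by (auto simp: partition_of_def)
  with Suc show ?case
    by (cases "k = Suc l") auto
qed simp

lemma partition_of_bounds:
  assumes "partition_of \<delta> s t n \<pi>" "k \<le> n"
  shows "s \<le> \<pi> k" "\<pi> k \<le> t"
  using partition_of_mono[OF assms(1), of 0 k] partition_of_mono[OF assms(1), of k n] assms
  by (auto simp: partition_of_def)

lemma partition_of_weaken: "partition_of \<delta> s t n \<pi> \<Longrightarrow> \<delta> \<le> \<delta>' \<Longrightarrow> partition_of \<delta>' s t n \<pi>"
  by (force simp: partition_of_def)

lemma partition_of_exists:
  assumes "s \<le> t" "0 < \<delta>"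
  obtains n \<pi> where "partition_of \<delta> s t n \<pi>"
proof -
  obtain n :: nat where n: "(t - s) / \<delta> < n"
    using reals_Archimedean2 by blast
  then have pos: "0 < real n"
    using assms by (smt (verit) divide_nonneg_pos)
  define h where "h = (t - s) / n"
  have "0 \<le> h" "h < \<delta>" "s + n * h = t"
    using n pos assms by (auto simp: h_def field_simps)
  then have "partition_of \<delta> s t n (\<lambda>k. s + k * h)"
    by (simp add: partition_of_def algebra_simps)
  then show ?thesis ..
qed

lemma sum_lessThan_add:
  fixes f :: "nat \<Rightarrow> 'b::comm_monoid_add"
  shows "(\<Sum>k<n + m. f k) = (\<Sum>k<n. f k) + (\<Sum>k<m. f (n + k))"
  by (induction m) (simp_all add: add.assoc)

text \<open>The two partitions share the point \<open>v\<close>, so the value at index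
  \<open>n\<close> may be read from either. The summand \<open>F\<close> sees both ends of a cell,
  which covers left and right endpoint sums alike.\<close>

lemma partition_of_append:
  assumes "partition_of \<delta> u v n \<pi>" "partition_of \<delta> v t m \<pi>'"
  defines "\<rho> \<equiv> \<lambda>k. if k \<le> n then \<pi> k else \<pi>' (k - n)"
  shows "partition_of \<delta> u t (n + m) \<rho>"
    and "(\<Sum>k<n + m. F (\<rho> k) (\<rho> (Suc k))) =
      (\<Sum>k<n. F (\<pi> k) (\<pi> (Suc k))) + (\<Sum>k<m. (F (\<pi>' k) (\<pi>' (Suc k)) :: 'b::comm_monoid_add))"
proof -
  have eq: "\<pi> n = \<pi>' 0"
    using assms by (simp add: partition_of_def)
  then have \<rho>: "\<rho> (n + k) = \<pi>' k" for k
    by (cases k) (auto simp: \<rho>_def)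
  have \<rho>': "\<rho> (Suc (n + k)) = \<pi>' (Suc k)" for k
    using \<rho>[of "Suc k"] by simp
  show "(\<Sum>k<n + m. F (\<rho> k) (\<rho> (Suc k))) = (\<Sum>k<n. F (\<pi> k) (\<pi> (Suc k))) + (\<Sum>k<m. F (\<pi>' k) (\<pi>' (Suc k)))"
    unfolding sum_lessThan_add \<rho> \<rho>' by (simp add: \<rho>_def)
  have "\<rho> k \<le> \<rho> (Suc k) \<and> \<rho> (Suc k) - \<rho> k < \<delta>" if "k < n + m" for k
  proof (cases "k < n")
    case True
    then show ?thesis
      using assms(1) by (simp add: \<rho>_def partition_of_def)
  next
    case False
    then have "k = n + (k - n)" "k - n < m"
      using that by auto
    then obtain j where "k = n + j" "j < m"
      by blast
    then show ?thesis
      using assms(2) by (simp add: \<rho> \<rho>' partition_of_def)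
  qed
  moreover have "\<rho> 0 = u" "\<rho> (n + m) = t"
    using assms(1,2) \<rho>[of m] by (simp_all add: partition_of_def \<rho>_def)
  ultimately show "partition_of \<delta> u t (n + m) \<rho>"
    unfolding partition_of_def by blast
qed

lemma (in finite_measure) measure_norm_add_le:
  fixes f g :: "'a \<Rightarrow> 'b::{second_countable_topology, real_normed_vector}"
  assumes [measurable]: "f \<in> borel_measurable M" "g \<in> borel_measurable M"
    and "\<And>\<omega>. \<omega> \<in> space M \<Longrightarrow> norm (h \<omega>) \<le> norm (f \<omega>) + norm (g \<omega>)"
  shows "measure M {\<omega> \<in> space M. norm (h \<omega>) > x + y} \<le>
    measure M {\<omega> \<in> space M. norm (f \<omega>) > x} + measure M {\<omega> \<in> space M. norm (g \<omega>) > y}"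
proof -
  have "measure M {\<omega> \<in> space M. norm (h \<omega>) > x + y} \<le>
      measure M ({\<omega> \<in> space M. norm (f \<omega>) > x} \<union> {\<omega> \<in> space M. norm (g \<omega>) > y})"
    by (rule finite_measure_mono) (use assms(3) in fastforce, measurable)
  also have "\<dots> \<le> measure M {\<omega> \<in> space M. norm (f \<omega>) > x} + measure M {\<omega> \<in> space M. norm (g \<omega>) > y}"
    by (rule measure_Un_le) measurable
  finally show ?thesis .
qed

text \<open>The equation supplies the noise integral only over intervals that end at
  \<open>t\<close>. A fine partition of \<open>{u..v}\<close> followed by one of
  \<open>{v..t}\<close> is a fine partition of \<open>{u..t}\<close>; the sums over
  \<open>{u..t}\<close> and \<open>{v..t}\<close> are close to \<open>I\<close> and
  \<open>J\<close>, and their difference is the sum over \<open>{u..v}\<close>.\<close>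

lemma backward_integral_subinterval:
  fixes Y :: "real \<Rightarrow> 'w \<Rightarrow> 'a::euclidean_space"
  assumes "finite_measure M" and "u \<le> v" "v \<le> t"
    and I: "has_backward_integral M (*\<^sub>R) (\<lambda>r _. \<sigma> r) Y u t I"
    and J: "has_backward_integral M (*\<^sub>R) (\<lambda>r _. \<sigma> r) Y v t J"
  shows "mesh_limit_in_prob M (\<lambda>n \<pi> \<omega>. \<Sum>k<n. \<sigma> (\<pi> (Suc k)) *\<^sub>R (Y (\<pi> (Suc k)) \<omega> - Y (\<pi> k) \<omega>))
    u v (\<lambda>\<omega>. I \<omega> - J \<omega>)"
  unfolding mesh_limit_in_prob_def
proof (intro conjI allI impI)
  interpret finite_measure M by fact
  have [measurable]: "I \<in> borel_measurable M" "J \<in> borel_measurable M"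
    and Y: "\<And>r. r \<in> {u..t} \<Longrightarrow> Y r \<in> borel_measurable M"
    using I J by (auto simp: has_backward_integral_def mesh_limit_in_prob_def)
  show "(\<lambda>\<omega>. I \<omega> - J \<omega>) \<in> borel_measurable M"
    by measurable
  fix e \<eta> :: real assume "0 < e" "0 < \<eta>"
  define S where "S n \<pi> \<omega> = (\<Sum>k<n. \<sigma> (\<pi> (Suc k)) *\<^sub>R (Y (\<pi> (Suc k)) \<omega> - Y (\<pi> k) \<omega>))" for n \<pi> \<omega>
  have "\<exists>\<delta>>0. \<forall>n \<pi>. partition_of \<delta> u t n \<pi> \<longrightarrow> measure M {\<omega> \<in> space M. norm (S n \<pi> \<omega> - I \<omega>) > e/2} < \<eta>/2"
    using I \<open>0 < e\<close> \<open>0 < \<eta>\<close> unfolding has_backward_integral_def mesh_limit_in_prob_def S_def by (meson half_gt_zero)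
  then obtain \<delta>1 where "0 < \<delta>1" and \<delta>1: "\<And>n \<pi>. partition_of \<delta>1 u t n \<pi> \<Longrightarrow>
      measure M {\<omega> \<in> space M. norm (S n \<pi> \<omega> - I \<omega>) > e/2} < \<eta>/2"
    by blast
  have "\<exists>\<delta>>0. \<forall>n \<pi>. partition_of \<delta> v t n \<pi> \<longrightarrow> measure M {\<omega> \<in> space M. norm (S n \<pi> \<omega> - J \<omega>) > e/2} < \<eta>/2"
    using J \<open>0 < e\<close> \<open>0 < \<eta>\<close> unfolding has_backward_integral_def mesh_limit_in_prob_def S_def by (meson half_gt_zero)
  then obtain \<delta>2 where "0 < \<delta>2" and \<delta>2: "\<And>n \<pi>. partition_of \<delta>2 v t n \<pi> \<Longrightarrow>
      measure M {\<omega> \<in> space M. norm (S n \<pi> \<omega> - J \<omega>) > e/2} < \<eta>/2"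
    by blast
  have "measure M {\<omega> \<in> space M. norm (S n \<pi> \<omega> - (I \<omega> - J \<omega>)) > e} < \<eta>"
    if \<pi>: "partition_of (min \<delta>1 \<delta>2) u v n \<pi>" for n \<pi>
  proof -
    obtain m \<pi>' where \<pi>': "partition_of (min \<delta>1 \<delta>2) v t m \<pi>'"
      using partition_of_exists[OF \<open>v \<le> t\<close>] \<open>0 < \<delta>1\<close> \<open>0 < \<delta>2\<close> by (metis min_less_iff_conj)
    define \<rho> where "\<rho> k = (if k \<le> n then \<pi> k else \<pi>' (k - n))" for k
    have \<rho>: "partition_of (min \<delta>1 \<delta>2) u t (n + m) \<rho>"
      and S: "S (n + m) \<rho> \<omega> = S n \<pi> \<omega> + S m \<pi>' \<omega>" for \<omega>
      unfolding S_def \<rho>_def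
      using partition_of_append(1)[OF \<pi> \<pi>']
        partition_of_append(2)[OF \<pi> \<pi>', of "\<lambda>x y. \<sigma> y *\<^sub>R (Y y \<omega> - Y x \<omega>)"] by auto
    have "\<rho> k \<in> {u..t}" if "k \<le> n + m" for k
      using partition_of_bounds[OF \<rho> that] by simp
    moreover have "\<pi>' k \<in> {u..t}" if "k \<le> m" for k
      using partition_of_bounds[OF \<pi>' that] \<open>u \<le> v\<close> by simp
    ultimately have [measurable]: "S (n + m) \<rho> \<in> borel_measurable M" "S m \<pi>' \<in> borel_measurable M"
      unfolding S_def
      by (auto intro!: borel_measurable_sum borel_measurable_scaleR borel_measurable_diff Y)
    have "measure M {\<omega> \<in> space M. norm (S n \<pi> \<omega> - (I \<omega> - J \<omega>)) > e/2 + e/2} \<le>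
      measure M {\<omega> \<in> space M. norm (S (n + m) \<rho> \<omega> - I \<omega>) > e/2} + measure M {\<omega> \<in> space M. norm (S m \<pi>' \<omega> - J \<omega>) > e/2}"
    proof (rule measure_norm_add_le)
      show "norm (S n \<pi> \<omega> - (I \<omega> - J \<omega>)) \<le> norm (S (n + m) \<rho> \<omega> - I \<omega>) + norm (S m \<pi>' \<omega> - J \<omega>)" for \<omega>
      proof -
        have "S n \<pi> \<omega> - (I \<omega> - J \<omega>) = (S (n + m) \<rho> \<omega> - I \<omega>) - (S m \<pi>' \<omega> - J \<omega>)"
          unfolding S by simp
        then show ?thesis
          by (metis norm_triangle_ineq4)
      qed
    qed measurable
    also have "\<dots> < \<eta>/2 + \<eta>/2"
      using \<delta>1[OF partition_of_weaken[OF \<rho>]] \<delta>2[OF partition_of_weaken[OF \<pi>']] by simp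
    finally show ?thesis by simp
  qed
  then show "\<exists>\<delta>>0. \<forall>n \<pi>. partition_of \<delta> u v n \<pi> \<longrightarrow> measure M {\<omega> \<in> space M.
      norm ((\<Sum>k<n. \<sigma> (\<pi> (Suc k)) *\<^sub>R (Y (\<pi> (Suc k)) \<omega> - Y (\<pi> k) \<omega>)) - (I \<omega> - J \<omega>)) > e} < \<eta>"
    unfolding S_def using \<open>0 < \<delta>1\<close> \<open>0 < \<delta>2\<close> by (intro exI[of _ "min \<delta>1 \<delta>2"]) auto
qed

section \<open>Chebyshev estimate for the noise\<close>

text \<open>Each \<open>D i\<close> is merely a limit in probability, so its second moment is not at
  hand. It is replaced by a Wiener sum over a fine partition of its interval; the second moment of
  the resulting sum is bounded by orthogonality, and a tail bound, unlike a moment, survives the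
  replacement.\<close>

lemma wiener_increments_tail_bound:
  fixes W :: "real \<Rightarrow> 'w \<Rightarrow> 'a::euclidean_space" and u v :: "'i \<Rightarrow> real" and C :: real
  assumes bb: "backward_brownian M G s t W" and "finite A"
    and uv: "\<And>i. i \<in> A \<Longrightarrow> s \<le> u i \<and> u i \<le> v i \<and> v i \<le> t"
    and disj: "\<And>i j. i \<in> A \<Longrightarrow> j \<in> A \<Longrightarrow> i \<noteq> j \<Longrightarrow> v i \<le> u j \<or> v j \<le> u i"
    and H: "\<And>i. i \<in> A \<Longrightarrow> H i \<in> borel_measurable (G (v i))"
    and bd: "\<And>i \<omega>. i \<in> A \<Longrightarrow> \<omega> \<in> space M \<Longrightarrow> norm (H i \<omega>) \<le> K"
    and C: "\<And>r. r \<in> {s..t} \<Longrightarrow> \<bar>\<sigma> r\<bar> \<le> C"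
    and D: "\<And>i. i \<in> A \<Longrightarrow> mesh_limit_in_prob M
      (\<lambda>n \<pi> \<omega>. \<Sum>k<n. \<sigma> (\<pi> (Suc k)) *\<^sub>R (W (\<pi> (Suc k)) \<omega> - W (\<pi> k) \<omega>)) (u i) (v i) (D i)"
    and "0 < e"
  shows "measure M {\<omega> \<in> space M. \<bar>\<Sum>i\<in>A. H i \<omega> \<bullet> D i \<omega>\<bar> > e}
    \<le> 4 * DIM('a) * C\<^sup>2 / e\<^sup>2 * (\<Sum>i\<in>A. (v i - u i) * (\<integral>\<omega>. (norm (H i \<omega>))\<^sup>2 \<partial>M))" (is "?P \<le> ?R")
\<comment> \<open>The slack \<eta> pays for the event on which some \<open>D i\<close> is far from
  its Wiener sum.\<close>
proof (rule field_le_epsilon)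
  fix \<eta> :: real assume "0 < \<eta>"
  interpret prob_space M using bb by (simp add: backward_brownian_def)
  have sub: "subalgebra M (G x)" if "s \<le> x" "x \<le> t" for x
    using bb that by (auto simp: backward_brownian_def)
  have sub2: "subalgebra (G x) (G y)" if "s \<le> x" "x \<le> y" "y \<le> t" for x y
    using bb that by (auto simp: backward_brownian_def)
  have WM: "W x \<in> borel_measurable M" if "s \<le> x" "x \<le> t" for x
    using measurable_from_subalg[OF sub, of x "W x" borel] bb that by (auto simp: backward_brownian_def)
  have HM: "H i \<in> borel_measurable M" if "i \<in> A" for i
    using measurable_from_subalg[OF sub H] uv that by force
  have DM: "D i \<in> borel_measurable M" if "i \<in> A" for i
    using D[OF that] by (simp add: mesh_limit_in_prob_def)
  \<comment> \<open>The added 1 keeps \<open>N\<close> and \<open>K'\<close> positive. Fewer than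
    \<open>N\<close> replacements, each off by at most \<open>e'\<close> and weighted by at most
    \<open>K'\<close>, change the sum by at most \<open>e / 2\<close>.\<close>
  define N where "N = real (card A) + 1"
  define K' where "K' = \<bar>K\<bar> + 1"
  define e' where "e' = e / (2 * K' * N)"
  have pos: "0 < N" "0 < K'" "0 < e'" "0 < \<eta> / N"
    using \<open>0 < e\<close> \<open>0 < \<eta>\<close> by (auto simp: N_def K'_def e'_def)
  define S where "S n \<pi> \<omega> = (\<Sum>k<n. \<sigma> (\<pi> (Suc k)) *\<^sub>R (W (\<pi> (Suc k)) \<omega> - W (\<pi> k) \<omega>))" for n \<pi> \<omega>
  define good where "good i n \<pi> \<delta> \<longleftrightarrow> partition_of \<delta> (u i) (v i) n \<pi> \<and>
    measure M {\<omega> \<in> space M. norm (S n \<pi> \<omega> - D i \<omega>) > e'} < \<eta> / N" for i n \<pi> \<delta>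
  have "\<exists>n \<pi> \<delta>. good i n \<pi> \<delta>" if i: "i \<in> A" for i
  proof -
    obtain \<delta> where "0 < \<delta>" "\<And>n \<pi>. partition_of \<delta> (u i) (v i) n \<pi> \<Longrightarrow>
        measure M {\<omega> \<in> space M. norm (S n \<pi> \<omega> - D i \<omega>) > e'} < \<eta> / N"
      using D[OF i] pos unfolding mesh_limit_in_prob_def S_def by meson
    moreover obtain n \<pi> where "partition_of \<delta> (u i) (v i) n \<pi>"
      using partition_of_exists[OF _ \<open>0 < \<delta>\<close>] uv[OF i] by blast
    ultimately show ?thesis unfolding good_def by blast
  qed
  then obtain n \<pi> \<delta> where "\<And>i. i \<in> A \<Longrightarrow> good i (n i) (\<pi> i) (\<delta> i)"
    by metis
  then have part: "i \<in> A \<Longrightarrow> partition_of (\<delta> i) (u i) (v i) (n i) (\<pi> i)"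
    and close: "i \<in> A \<Longrightarrow> measure M {\<omega> \<in> space M. norm (S (n i) (\<pi> i) \<omega> - D i \<omega>) > e'} < \<eta> / N" for i
    unfolding good_def by blast+
  have bnd: "u i \<le> \<pi> i k" "\<pi> i k \<le> v i" "s \<le> \<pi> i k" "\<pi> i k \<le> t" if "i \<in> A" "k \<le> n i" for i k
    using partition_of_bounds[OF part[OF that(1)] that(2)] uv[OF that(1)] by auto
  have SM: "S (n i) (\<pi> i) \<in> borel_measurable M" if "i \<in> A" for i
    unfolding S_def using bnd[OF that]
    by (intro borel_measurable_sum borel_measurable_scaleR borel_measurable_diff WM borel_measurable_const) auto
  \<comment> \<open>The cells of all chosen partitions form one family of non-overlapping intervals,
    so orthogonality applies to the whole double sum at once.\<close>
  let ?B = "Sigma A (\<lambda>i. {..<n i})"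
  let ?u = "\<lambda>(i, k). \<pi> i k" and ?v = "\<lambda>(i, k). \<pi> i (Suc k)"
  let ?H = "\<lambda>(i, k) \<omega>. \<sigma> (\<pi> i (Suc k)) *\<^sub>R H i \<omega>"
  have HS: "(\<Sum>i\<in>A. H i \<omega> \<bullet> S (n i) (\<pi> i) \<omega>) = (\<Sum>x\<in>?B. ?H x \<omega> \<bullet> (W (?v x) \<omega> - W (?u x) \<omega>))" for \<omega>
    unfolding S_def using \<open>finite A\<close> by (simp add: inner_sum_right sum.Sigma case_prod_unfold)
  have fin: "finite ?B"
    using \<open>finite A\<close> by simp
  have B1: "s \<le> ?u x \<and> ?u x \<le> ?v x \<and> ?v x \<le> t" if "x \<in> ?B" for x
    using that bnd part by (auto simp: partition_of_def Suc_le_eq)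
  have B2: "?v x \<le> ?u y \<or> ?v y \<le> ?u x" if "x \<in> ?B" "y \<in> ?B" "x \<noteq> y" for x y
  proof -
    obtain i k j l where xy: "x = (i, k)" "y = (j, l)" by fastforce
    with that have ij: "i \<in> A" "k < n i" "j \<in> A" "l < n j" by auto
    show ?thesis
    proof (cases "i = j")
      case True
      then have "k < l \<or> l < k" using that xy by auto
      then show ?thesis
        using ij partition_of_mono[OF part[OF ij(1)], of "Suc k" l] partition_of_mono[OF part[OF ij(1)], of "Suc l" k] True
        by (auto simp: xy)
    next
      case False
      then show ?thesis
        using disj[OF ij(1,3)] bnd[OF ij(1), of "Suc k"] bnd[OF ij(3), of l] bnd[OF ij(1), of k] bnd[OF ij(3), of "Suc l"] ij
        by (auto simp: xy)
    qed
  qed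
  have B3: "?H x \<in> borel_measurable (G (?v x))" if "x \<in> ?B" for x
  proof -
    obtain i k where x: "x = (i, k)" by fastforce
    with that have ik: "i \<in> A" "k < n i" by auto
    \<comment> \<open>A cell ends no later than \<open>v i\<close>, and earlier times carry more
      information.\<close>
    have "H i \<in> borel_measurable (G (\<pi> i (Suc k)))"
      using measurable_from_subalg[OF sub2 H[OF ik(1)]] bnd[OF ik(1), of "Suc k"] ik uv[OF ik(1)] by auto
    then show ?thesis
      by (auto simp: x)
  qed
  have \<sigma>C: "\<bar>\<sigma> (\<pi> i (Suc k))\<bar> \<le> C" if "i \<in> A" "k < n i" for i k
    using C bnd[OF that(1), of "Suc k"] that by auto
  have B4: "norm (?H x \<omega>) \<le> C * K" if "x \<in> ?B" "\<omega> \<in> space M" for x \<omega>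
  proof -
    obtain i k where x: "x = (i, k)" by fastforce
    with that have ik: "i \<in> A" "k < n i" by auto
    have "\<bar>\<sigma> (\<pi> i (Suc k))\<bar> * norm (H i \<omega>) \<le> C * K"
      using \<sigma>C[OF ik] bd[OF ik(1) that(2)] by (intro mult_mono) auto
    then show ?thesis
      by (simp add: x)
  qed
  note second = backward_brownian_second_moment[OF bb fin B1 B2 B3 B4]
  have intH2: "integrable M (\<lambda>\<omega>. (norm (H i \<omega>))\<^sup>2)" if "i \<in> A" for i
    by (rule integrable_const_bound[where B = "K\<^sup>2"]) (use bd HM that in \<open>auto intro!: power_mono\<close>)
  have "(\<Sum>x\<in>?B. (?v x - ?u x) * (\<integral>\<omega>. (norm (?H x \<omega>))\<^sup>2 \<partial>M)) =
      (\<Sum>i\<in>A. \<Sum>k<n i. (\<pi> i (Suc k) - \<pi> i k) * ((\<sigma> (\<pi> i (Suc k)))\<^sup>2 * (\<integral>\<omega>. (norm (H i \<omega>))\<^sup>2 \<partial>M)))"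
    using \<open>finite A\<close> by (simp add: sum.Sigma case_prod_unfold power_mult_distrib)
  also have "\<dots> \<le> (\<Sum>i\<in>A. \<Sum>k<n i. (\<pi> i (Suc k) - \<pi> i k) * (C\<^sup>2 * (\<integral>\<omega>. (norm (H i \<omega>))\<^sup>2 \<partial>M)))"
  proof (intro sum_mono mult_left_mono mult_right_mono)
    fix i k assume ik: "i \<in> A" "k \<in> {..<n i}"
    then show "(\<sigma> (\<pi> i (Suc k)))\<^sup>2 \<le> C\<^sup>2"
      using \<sigma>C[of i k] by (simp add: abs_le_square_iff[symmetric])
    show "0 \<le> \<pi> i (Suc k) - \<pi> i k"
      using part ik by (auto simp: partition_of_def)
  qed simp
  also have "\<dots> = (\<Sum>i\<in>A. (v i - u i) * (C\<^sup>2 * (\<integral>\<omega>. (norm (H i \<omega>))\<^sup>2 \<partial>M)))"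
    using part by (simp add: sum_distrib_right[symmetric] sum_lessThan_telescope partition_of_def)
  also have "\<dots> = C\<^sup>2 * (\<Sum>i\<in>A. (v i - u i) * (\<integral>\<omega>. (norm (H i \<omega>))\<^sup>2 \<partial>M))"
    by (simp add: sum_distrib_left mult_ac)
  finally have le: "(\<Sum>x\<in>?B. (?v x - ?u x) * (\<integral>\<omega>. (norm (?H x \<omega>))\<^sup>2 \<partial>M)) \<le> \<dots>" .
  let ?Q = "\<lambda>\<omega>. \<Sum>i\<in>A. H i \<omega> \<bullet> S (n i) (\<pi> i) \<omega>"
  have QM[measurable]: "?Q \<in> borel_measurable M"
    using HM SM by auto
  have intQ: "integrable M (\<lambda>\<omega>. (?Q \<omega>)\<^sup>2)"
    unfolding HS by (rule second(1))
  have EQ: "(\<integral>\<omega>. (?Q \<omega>)\<^sup>2 \<partial>M) \<le> DIM('a) * (C\<^sup>2 * (\<Sum>i\<in>A. (v i - u i) * (\<integral>\<omega>. (norm (H i \<omega>))\<^sup>2 \<partial>M)))"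
    unfolding HS by (rule order_trans[OF second(2)]) (use le in \<open>auto intro: mult_left_mono\<close>)
  \<comment> \<open>Chebyshev at level \<open>e / 2\<close>, the other half being reserved for the
    replacement error; hence the factor 4 in the bound.\<close>
  have "measure M {\<omega> \<in> space M. \<bar>?Q \<omega>\<bar> > e/2} \<le> measure M {\<omega> \<in> space M. (?Q \<omega>)\<^sup>2 \<ge> (e/2)\<^sup>2}"
  proof (rule finite_measure_mono)
    show "{\<omega> \<in> space M. \<bar>?Q \<omega>\<bar> > e/2} \<subseteq> {\<omega> \<in> space M. (?Q \<omega>)\<^sup>2 \<ge> (e/2)\<^sup>2}"
      using \<open>0 < e\<close> by (auto simp: abs_le_square_iff[symmetric])
  qed measurable
  also have "\<dots> \<le> (\<integral>\<omega>. (?Q \<omega>)\<^sup>2 \<partial>M) / (e/2)\<^sup>2"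
    by (rule integral_Markov_inequality_measure[OF intQ, of "{}"]) (use \<open>0 < e\<close> in auto)
  also have "\<dots> \<le> DIM('a) * (C\<^sup>2 * (\<Sum>i\<in>A. (v i - u i) * (\<integral>\<omega>. (norm (H i \<omega>))\<^sup>2 \<partial>M))) / (e/2)\<^sup>2"
    using EQ by (rule divide_right_mono) simp
  also have "\<dots> = ?R"
    by (simp add: power_divide)
  finally have Q: "measure M {\<omega> \<in> space M. \<bar>?Q \<omega>\<bar> > e/2} \<le> ?R" .
  let ?Z = "\<lambda>i. {\<omega> \<in> space M. norm (S (n i) (\<pi> i) \<omega> - D i \<omega>) > e'}"
  have ZM: "?Z i \<in> sets M" if "i \<in> A" for i
    using SM[OF that] DM[OF that] by measurable
  have "?P \<le> measure M ({\<omega> \<in> space M. \<bar>?Q \<omega>\<bar> > e/2} \<union> (\<Union>i\<in>A. ?Z i))"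
  proof (rule finite_measure_mono)
    show "{\<omega> \<in> space M. \<bar>\<Sum>i\<in>A. H i \<omega> \<bullet> D i \<omega>\<bar> > e} \<subseteq> {\<omega> \<in> space M. \<bar>?Q \<omega>\<bar> > e/2} \<union> (\<Union>i\<in>A. ?Z i)"
    proof (rule subsetI, rule ccontr)
      fix \<omega> assume \<omega>: "\<omega> \<in> {\<omega> \<in> space M. \<bar>\<Sum>i\<in>A. H i \<omega> \<bullet> D i \<omega>\<bar> > e}"
        and not: "\<omega> \<notin> {\<omega> \<in> space M. \<bar>?Q \<omega>\<bar> > e/2} \<union> (\<Union>i\<in>A. ?Z i)"
      have "\<bar>(\<Sum>i\<in>A. H i \<omega> \<bullet> D i \<omega>) - ?Q \<omega>\<bar> = \<bar>\<Sum>i\<in>A. H i \<omega> \<bullet> (D i \<omega> - S (n i) (\<pi> i) \<omega>)\<bar>"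
        by (simp add: inner_diff_right sum_subtractf)
      also have "\<dots> \<le> (\<Sum>i\<in>A. K' * e')"
      proof (rule order_trans[OF sum_abs sum_mono])
        fix i assume i: "i \<in> A"
        have "\<bar>H i \<omega> \<bullet> (D i \<omega> - S (n i) (\<pi> i) \<omega>)\<bar> \<le> norm (H i \<omega>) * norm (D i \<omega> - S (n i) (\<pi> i) \<omega>)"
          by (rule Cauchy_Schwarz_ineq2)
        also have "\<dots> \<le> K' * e'"
        proof (rule mult_mono)
          show "norm (H i \<omega>) \<le> K'"
            using bd[OF i, of \<omega>] \<omega> by (simp add: K'_def)
          show "norm (D i \<omega> - S (n i) (\<pi> i) \<omega>) \<le> e'"
            using not \<omega> i by (auto simp: norm_minus_commute not_less)
        qed (use pos in auto)
        finally show "\<bar>H i \<omega> \<bullet> (D i \<omega> - S (n i) (\<pi> i) \<omega>)\<bar> \<le> K' * e'" .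
      qed
      also have "\<dots> \<le> N * (K' * e')"
        using pos by (simp add: N_def)
      also have "\<dots> = e / 2"
        using pos unfolding e'_def by (simp add: field_simps)
      finally have "\<bar>(\<Sum>i\<in>A. H i \<omega> \<bullet> D i \<omega>) - ?Q \<omega>\<bar> \<le> e / 2" .
      moreover have "\<bar>?Q \<omega>\<bar> \<le> e / 2" "e < \<bar>\<Sum>i\<in>A. H i \<omega> \<bullet> D i \<omega>\<bar>"
        using not \<omega> by auto
      ultimately show False by linarith
    qed
    show "{\<omega> \<in> space M. \<bar>?Q \<omega>\<bar> > e/2} \<union> (\<Union>i\<in>A. ?Z i) \<in> sets M"
      using ZM \<open>finite A\<close> by (intro sets.Un sets.finite_UN) auto
  qed
  also have "\<dots> \<le> measure M {\<omega> \<in> space M. \<bar>?Q \<omega>\<bar> > e/2} + measure M (\<Union>i\<in>A. ?Z i)"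
    using ZM \<open>finite A\<close> by (intro measure_Un_le) auto
  also have "measure M (\<Union>i\<in>A. ?Z i) \<le> (\<Sum>i\<in>A. measure M (?Z i))"
    using ZM \<open>finite A\<close> by (intro finite_measure_subadditive_finite) auto
  also have "\<dots> \<le> (\<Sum>i\<in>A. \<eta> / N)"
    using close by (intro sum_mono) (auto intro: less_imp_le)
  also have "\<dots> \<le> \<eta>"
    using \<open>0 < \<eta>\<close> pos by (simp add: N_def field_simps)
  finally show "?P \<le> ?R + \<eta>"
    using Q by linarith
qed

section \<open>Uniformity in time for continuous processes\<close>

text \<open>Path continuity gives a modulus that depends on \<omega>; the bound \<open>K\<close>
  trades it for a modulus in mean. If no \<delta> worked, pairs of times at vanishing distance would
  have subsequences with a common limit \<open>l\<close>, and dominated convergence would send the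
  mean difference to 0.\<close>

lemma bounded_continuous_process_L1_uniform:
  fixes g :: "real \<Rightarrow> 'w \<Rightarrow> 'a::euclidean_space"
  assumes "finite_measure M"
    and meas: "\<And>r. r \<in> {s..t} \<Longrightarrow> g r \<in> borel_measurable M"
    and cont: "\<And>\<omega>. \<omega> \<in> space M \<Longrightarrow> continuous_on {s..t} (\<lambda>r. g r \<omega>)"
    and bd: "\<And>r \<omega>. r \<in> {s..t} \<Longrightarrow> \<omega> \<in> space M \<Longrightarrow> norm (g r \<omega>) \<le> K"
    and "0 < \<kappa>"
  obtains \<delta> where "0 < \<delta>"
    "\<And>u v. u \<in> {s..t} \<Longrightarrow> v \<in> {s..t} \<Longrightarrow> \<bar>u - v\<bar> < \<delta> \<Longrightarrow> (\<integral>\<omega>. norm (g u \<omega> - g v \<omega>) \<partial>M) < \<kappa>"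
proof (rule ccontr)
  interpret finite_measure M by fact
  assume "\<not> thesis"
  with that have neg: "\<exists>u\<in>{s..t}. \<exists>v\<in>{s..t}. \<bar>u - v\<bar> < \<delta> \<and> \<kappa> \<le> (\<integral>\<omega>. norm (g u \<omega> - g v \<omega>) \<partial>M)" if "0 < \<delta>" for \<delta>
    using that by (meson not_less)
  have "\<forall>n. \<exists>u v. u \<in> {s..t} \<and> v \<in> {s..t} \<and> \<bar>u - v\<bar> < inverse (real (Suc n)) \<and> \<kappa> \<le> (\<integral>\<omega>. norm (g u \<omega> - g v \<omega>) \<partial>M)"
  proof
    fix n
    show "\<exists>u v. u \<in> {s..t} \<and> v \<in> {s..t} \<and> \<bar>u - v\<bar> < inverse (real (Suc n)) \<and> \<kappa> \<le> (\<integral>\<omega>. norm (g u \<omega> - g v \<omega>) \<partial>M)"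
      using neg[of "inverse (real (Suc n))"] unfolding Bex_def by force
  qed
  then obtain U V where U: "\<And>n. U n \<in> {s..t}" and V: "\<And>n. V n \<in> {s..t}"
    and UV: "\<And>n. \<bar>U n - V n\<bar> < inverse (real (Suc n))"
    and big: "\<And>n. \<kappa> \<le> (\<integral>\<omega>. norm (g (U n) \<omega> - g (V n) \<omega>) \<partial>M)"
    by metis
  have "seq_compact {s..t}"
    using compact_Icc compact_eq_seq_compact_metric by blast
  then obtain l r where l: "l \<in> {s..t}" and r: "strict_mono r" and Ul: "(\<lambda>n. U (r n)) \<longlonglongrightarrow> l"
    using seq_compactE[of "{s..t}" U] U by (auto simp: comp_def)
  have "(\<lambda>n. U n - V n) \<longlonglongrightarrow> 0"
    by (rule Lim_null_comparison[OF _ LIMSEQ_inverse_real_of_nat]) (use UV in \<open>auto intro!: always_eventually less_imp_le\<close>)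
  from LIMSEQ_subseq_LIMSEQ[OF this r] have "(\<lambda>n. U (r n) - V (r n)) \<longlonglongrightarrow> 0"
    by (simp add: comp_def)
  from tendsto_diff[OF Ul this] have Vl: "(\<lambda>n. V (r n)) \<longlonglongrightarrow> l"
    by simp
  have "(\<lambda>n. \<integral>\<omega>. norm (g (U (r n)) \<omega> - g (V (r n)) \<omega>) \<partial>M) \<longlonglongrightarrow> (\<integral>\<omega>. 0 \<partial>M)"
  proof (rule integral_dominated_convergence[where w = "\<lambda>_. 2 * K"])
    show "AE \<omega> in M. (\<lambda>n. norm (g (U (r n)) \<omega> - g (V (r n)) \<omega>)) \<longlonglongrightarrow> 0"
    proof (rule AE_I2)
      fix \<omega> assume \<omega>: "\<omega> \<in> space M"
      have "(\<lambda>n. g (U (r n)) \<omega> - g (V (r n)) \<omega>) \<longlonglongrightarrow> g l \<omega> - g l \<omega>"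
        by (intro tendsto_diff continuous_on_tendsto_compose[OF cont[OF \<omega>]] Ul Vl l always_eventually allI U V)
      then show "(\<lambda>n. norm (g (U (r n)) \<omega> - g (V (r n)) \<omega>)) \<longlonglongrightarrow> 0"
        using tendsto_norm_zero by fastforce
    qed
    show "AE \<omega> in M. norm (norm (g (U (r n)) \<omega> - g (V (r n)) \<omega>)) \<le> 2 * K" for n
    proof (rule AE_I2)
      fix \<omega> assume "\<omega> \<in> space M"
      then show "norm (norm (g (U (r n)) \<omega> - g (V (r n)) \<omega>)) \<le> 2 * K"
        using bd[OF U[of "r n"]] bd[OF V[of "r n"]] norm_triangle_ineq4[of "g (U (r n)) \<omega>" "g (V (r n)) \<omega>"] by fastforce
    qed
  qed (use meas U V in auto)
  then have "(\<lambda>n. \<integral>\<omega>. norm (g (U (r n)) \<omega> - g (V (r n)) \<omega>) \<partial>M) \<longlonglongrightarrow> 0"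
    by simp
  from LIMSEQ_le_const[OF this, of \<kappa>] big \<open>0 < \<kappa>\<close> show False
    by (meson not_less)
qed

text \<open>Each path is bounded on the compact interval, so the events on which \<open>n\<close> is
  a bound increase to the whole space. They are measurable because, by continuity, a bound on a
  countable dense set of times suffices.\<close>

lemma continuous_process_bounded_in_prob:
  fixes g :: "real \<Rightarrow> 'w \<Rightarrow> 'a::euclidean_space"
  assumes "finite_measure M"
    and meas: "\<And>r. r \<in> {s..t} \<Longrightarrow> g r \<in> borel_measurable M"
    and cont: "\<And>\<omega>. \<omega> \<in> space M \<Longrightarrow> continuous_on {s..t} (\<lambda>r. g r \<omega>)"
    and "0 < \<eta>"
  obtains K E where "0 < K" "E \<in> sets M" "measure M (space M - E) < \<eta>"
    "\<And>\<omega> r. \<omega> \<in> E \<Longrightarrow> r \<in> {s..t} \<Longrightarrow> norm (g r \<omega>) \<le> K"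
proof -
  interpret finite_measure M by fact
  obtain T where T: "countable T" "T \<subseteq> {s..t}" "{s..t} \<subseteq> closure T"
    using separable by blast
  then have T': "closure T = {s..t}"
    by (simp add: closure_minimal subset_antisym)
  define A where "A n = {\<omega> \<in> space M. \<forall>r\<in>T. norm (g r \<omega>) \<le> real n}" for n
  have AM: "A n \<in> sets M" for n
    unfolding A_def
  proof (rule sets.sets_Collect_countable_All')
    fix r assume "r \<in> T"
    then have [measurable]: "g r \<in> borel_measurable M"
      using meas T by auto
    show "{\<omega> \<in> space M. norm (g r \<omega>) \<le> real n} \<in> sets M" by measurable
  qed fact
  have bd: "norm (g r \<omega>) \<le> real n" if "\<omega> \<in> A n" "r \<in> {s..t}" for r \<omega> n
  proof (rule continuous_on_closure_norm_le[where s = T and f = "\<lambda>r. g r \<omega>"])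
    show "continuous_on (closure T) (\<lambda>r. g r \<omega>)"
      using cont that by (simp add: T' A_def)
  qed (use that T' in \<open>auto simp: A_def\<close>)
  have "(\<lambda>n. measure M (A n)) \<longlonglongrightarrow> measure M (\<Union>n. A n)"
    using AM by (intro finite_Lim_measure_incseq) (auto simp: A_def incseq_def intro: order_trans)
  also have "(\<Union>n. A n) = space M"
  proof (intro equalityI subsetI)
    fix \<omega> assume \<omega>: "\<omega> \<in> space M"
    have "bounded ((\<lambda>r. g r \<omega>) ` {s..t})"
      by (intro compact_imp_bounded compact_continuous_image cont \<omega> compact_Icc)
    then obtain B where B: "\<And>r. r \<in> {s..t} \<Longrightarrow> norm (g r \<omega>) \<le> B"
      unfolding bounded_iff by blast
    obtain n :: nat where "B \<le> n"
      using real_arch_simple by blast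
    then have "\<omega> \<in> A n"
      using B T \<omega> unfolding A_def by force
    then show "\<omega> \<in> (\<Union>n. A n)" by blast
  qed (auto simp: A_def)
  finally have "eventually (\<lambda>n. measure M (A n) > measure M (space M) - \<eta>) sequentially"
    using \<open>0 < \<eta>\<close> by (intro order_tendstoD) auto
  then obtain n where n: "measure M (A n) > measure M (space M) - \<eta>"
    by (auto simp: eventually_sequentially)
  show ?thesis
  \<comment> \<open>The added 1 makes the bound positive, so that it can serve as a truncation
    radius.\<close>
  proof (rule that[of "real n + 1" "A n"])
    show "measure M (space M - A n) < \<eta>"
      using n AM by (simp add: finite_measure_compl)
    show "norm (g r \<omega>) \<le> real n + 1" if "\<omega> \<in> A n" "r \<in> {s..t}" for \<omega> r
      using bd[OF that] by simp
  qed (use AM in auto)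
qed

section \<open>Completeness, uniqueness and linearity of mesh limits\<close>

text \<open>Along partitions whose successive deviations are summable, Borel-Cantelli yields an
  almost sure limit. The Cauchy property then carries this limit from the one sequence to all fine
  partitions.\<close>

lemma mesh_limit_in_prob_Cauchy:
  fixes S :: "nat \<Rightarrow> (nat \<Rightarrow> real) \<Rightarrow> 'w \<Rightarrow> real"
  assumes "finite_measure M" and "s \<le> t"
    and SM: "\<And>\<delta> n \<pi>. partition_of \<delta> s t n \<pi> \<Longrightarrow> S n \<pi> \<in> borel_measurable M"
    and Cauchy: "\<And>e \<eta>. 0 < e \<Longrightarrow> 0 < \<eta> \<Longrightarrow> \<exists>\<delta>>0. \<forall>n \<pi> m \<rho>.
      partition_of \<delta> s t n \<pi> \<longrightarrow> partition_of \<delta> s t m \<rho> \<longrightarrow>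
      measure M {\<omega> \<in> space M. \<bar>S n \<pi> \<omega> - S m \<rho> \<omega>\<bar> > e} < \<eta>"
  shows "\<exists>I. mesh_limit_in_prob M S s t I"
proof -
  interpret finite_measure M by fact
  define h :: "nat \<Rightarrow> real" where "h i = (1/2) ^ i" for i
  have h: "0 < h i" for i by (simp add: h_def)
  have summable_h: "summable h"
    unfolding h_def[abs_def] by (rule summable_geometric) simp
  have "\<forall>i. \<exists>\<delta>>0. \<forall>n \<pi> m \<rho>. partition_of \<delta> s t n \<pi> \<longrightarrow> partition_of \<delta> s t m \<rho> \<longrightarrow>
      measure M {\<omega> \<in> space M. \<bar>S n \<pi> \<omega> - S m \<rho> \<omega>\<bar> > h i} < h i"
    using Cauchy h by blast
  then obtain \<delta> where \<delta>: "\<And>i. 0 < \<delta> i" and close: "\<And>i n \<pi> m \<rho>. partition_of (\<delta> i) s t n \<pi> \<Longrightarrow>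
      partition_of (\<delta> i) s t m \<rho> \<Longrightarrow> measure M {\<omega> \<in> space M. \<bar>S n \<pi> \<omega> - S m \<rho> \<omega>\<bar> > h i} < h i"
    by metis
  \<comment> \<open>The minimum over all indices up to \<open>i\<close> makes the partition of index
    \<open>i + 1\<close> fine enough for \<open>\<delta> i\<close> too, so consecutive sums can be
    compared; the bound by \<open>h i\<close> sends the mesh to 0.\<close>
  define d where "d i = min (h i) (Min (\<delta> ` {..i}))" for i
  have d: "0 < d i" for i
    using h \<delta> by (simp add: d_def)
  have d\<delta>: "d i \<le> \<delta> j" if "j \<le> i" for i j
  proof -
    have "Min (\<delta> ` {..i}) \<le> \<delta> j"
      using that by (intro Min_le) auto
    then show ?thesis by (simp add: d_def)
  qed
  have "\<forall>i. \<exists>n \<pi>. partition_of (d i) s t n \<pi>"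
    using partition_of_exists[OF \<open>s \<le> t\<close> d] by metis
  then obtain n \<pi> where part: "\<And>i. partition_of (d i) s t (n i) (\<pi> i)"
    by metis
  define T where "T i = S (n i) (\<pi> i)" for i
  have [measurable]: "T i \<in> borel_measurable M" for i
    unfolding T_def by (rule SM[OF part])
  have T: "measure M {\<omega> \<in> space M. \<bar>T (Suc i) \<omega> - T i \<omega>\<bar> > h i} < h i" for i
    unfolding T_def by (rule close; rule partition_of_weaken[OF part]) (auto intro: d\<delta>)
  have "AE \<omega> in M. eventually (\<lambda>i. \<omega> \<in> space M - {\<omega> \<in> space M. \<bar>T (Suc i) \<omega> - T i \<omega>\<bar> > h i}) sequentially"
  proof (rule borel_cantelli_AE1)
    show "summable (\<lambda>i. measure M {\<omega> \<in> space M. \<bar>T (Suc i) \<omega> - T i \<omega>\<bar> > h i})"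
      by (rule summable_comparison_test'[where g = h]) (use T summable_h in \<open>auto simp: less_imp_le\<close>)
  qed (auto simp: less_top[symmetric])
  then have conv: "AE \<omega> in M. convergent (\<lambda>i. T i \<omega>)"
  proof eventually_elim
    case (elim \<omega>)
    have "summable (\<lambda>i. T (Suc i) \<omega> - T i \<omega>)"
    proof (rule summable_comparison_test_ev[where g = h])
      show "\<forall>\<^sub>F i in sequentially. norm (T (Suc i) \<omega> - T i \<omega>) \<le> h i"
        using elim by eventually_elim auto
    qed (rule summable_h)
    then have "convergent (\<lambda>k. \<Sum>i<k. T (Suc i) \<omega> - T i \<omega>)"
      by (simp add: summable_iff_convergent)
    then have "convergent (\<lambda>k. T k \<omega> - T 0 \<omega>)"
      by (simp only: sum_lessThan_telescope[of "\<lambda>k. T k \<omega>"])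
    then show ?case
      using convergent_diff_const_right_iff by blast
  qed
  define I where "I \<omega> = lim (\<lambda>i. T i \<omega>)" for \<omega>
  have [measurable]: "I \<in> borel_measurable M"
    unfolding I_def by measurable
  \<comment> \<open>Almost sure convergence gives convergence in probability, by dominated
    convergence of the indicators.\<close>
  have lim: "(\<lambda>i. measure M {\<omega> \<in> space M. \<bar>T i \<omega> - I \<omega>\<bar> > e}) \<longlonglongrightarrow> 0" if "0 < e" for e
  proof -
    have "(\<lambda>i. \<integral>\<omega>. indicator {\<omega> \<in> space M. \<bar>T i \<omega> - I \<omega>\<bar> > e} \<omega> \<partial>M) \<longlonglongrightarrow> (\<integral>\<omega>. (0::real) \<partial>M)"
    proof (rule integral_dominated_convergence[where w = "\<lambda>_. 1"])
      show "AE \<omega> in M. (\<lambda>i. indicator {\<omega> \<in> space M. \<bar>T i \<omega> - I \<omega>\<bar> > e} \<omega> :: real) \<longlonglongrightarrow> 0"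
        using conv
      proof eventually_elim
        case (elim \<omega>)
        then have "(\<lambda>i. T i \<omega>) \<longlonglongrightarrow> I \<omega>"
          unfolding I_def by (rule convergent_LIMSEQ_iff[THEN iffD1])
        then have "eventually (\<lambda>i. dist (T i \<omega>) (I \<omega>) < e) sequentially"
          using \<open>0 < e\<close> by (rule tendstoD)
        then show ?case
          by (intro tendsto_eventually) (auto elim!: eventually_mono simp: dist_real_def indicator_def)
      qed
    qed (auto simp: indicator_def)
    then show ?thesis
      by simp
  qed
  have "mesh_limit_in_prob M S s t I"
    unfolding mesh_limit_in_prob_def
  proof (intro conjI allI impI)
    fix e \<eta> :: real assume "0 < e" "0 < \<eta>"
    then have "0 < e/2" "0 < \<eta>/2"
      by auto
    from Cauchy[OF this] obtain \<delta>' where \<delta>': "0 < \<delta>'" "\<And>n \<pi> m \<rho>. partition_of \<delta>' s t n \<pi> \<Longrightarrow> partition_of \<delta>' s t m \<rho> \<Longrightarrow>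
      measure M {\<omega> \<in> space M. \<bar>S n \<pi> \<omega> - S m \<rho> \<omega>\<bar> > e/2} < \<eta>/2"
      by blast
    have "h \<longlonglongrightarrow> 0"
      unfolding h_def[abs_def] by (rule LIMSEQ_power_zero) simp
    then have "eventually (\<lambda>i. h i < \<delta>') sequentially"
      using \<delta>'(1) by (rule order_tendstoD)
    moreover have "eventually (\<lambda>i. measure M {\<omega> \<in> space M. \<bar>T i \<omega> - I \<omega>\<bar> > e/2} < \<eta>/2) sequentially"
      using lim[of "e/2"] \<open>0 < e\<close> \<open>0 < \<eta>\<close> by (intro order_tendstoD) auto
    ultimately have "eventually (\<lambda>i. h i < \<delta>' \<and>
        measure M {\<omega> \<in> space M. \<bar>T i \<omega> - I \<omega>\<bar> > e/2} < \<eta>/2) sequentially"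
      by (rule eventually_conj)
    from eventually_happens'[OF sequentially_bot this]
    obtain i where i: "h i < \<delta>'" "measure M {\<omega> \<in> space M. \<bar>T i \<omega> - I \<omega>\<bar> > e/2} < \<eta>/2"
      by blast
    have pi: "partition_of \<delta>' s t (n i) (\<pi> i)"
      by (rule partition_of_weaken[OF part]) (use i in \<open>auto simp: d_def\<close>)
    have "measure M {\<omega> \<in> space M. norm (S m \<rho> \<omega> - I \<omega>) > e} < \<eta>" if \<rho>: "partition_of \<delta>' s t m \<rho>" for m \<rho>
    proof -
      have [measurable]: "S m \<rho> \<in> borel_measurable M" by (rule SM[OF \<rho>])
      have "measure M {\<omega> \<in> space M. norm (S m \<rho> \<omega> - I \<omega>) > e/2 + e/2} \<le>
        measure M {\<omega> \<in> space M. norm (S m \<rho> \<omega> - T i \<omega>) > e/2} + measure M {\<omega> \<in> space M. norm (T i \<omega> - I \<omega>) > e/2}"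
        by (rule measure_norm_add_le) auto
      also have "\<dots> < \<eta>/2 + \<eta>/2"
        using \<delta>'(2)[OF \<rho> pi] i(2) by (simp add: T_def)
      finally show ?thesis by simp
    qed
    then show "\<exists>\<delta>>0. \<forall>n \<pi>. partition_of \<delta> s t n \<pi> \<longrightarrow>
        measure M {\<omega> \<in> space M. norm (S n \<pi> \<omega> - I \<omega>) > e} < \<eta>"
      using \<delta>'(1) by blast
  qed measurable
  then show ?thesis by blast
qed

text \<open>One partition that is fine for both limits ties them together up to \<open>e\<close>,
  with probability as close to 1 as desired; letting \<open>e\<close> run through a null sequence
  leaves a null set.\<close>

lemma mesh_limit_in_prob_unique:
  fixes S :: "nat \<Rightarrow> (nat \<Rightarrow> real) \<Rightarrow> 'w \<Rightarrow> real"
  assumes "finite_measure M" and "s \<le> t"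
    and SM: "\<And>\<delta> n \<pi>. partition_of \<delta> s t n \<pi> \<Longrightarrow> S n \<pi> \<in> borel_measurable M"
    and I: "mesh_limit_in_prob M S s t I" and J: "mesh_limit_in_prob M S s t J"
  shows "AE \<omega> in M. I \<omega> = J \<omega>"
proof -
  interpret finite_measure M by fact
  have [measurable]: "I \<in> borel_measurable M" "J \<in> borel_measurable M"
    using I J by (auto simp: mesh_limit_in_prob_def)
  have zero: "measure M {\<omega> \<in> space M. norm (I \<omega> - J \<omega>) > e} = 0" if "0 < e" for e
  proof (rule antisym[OF field_le_epsilon measure_nonneg])
    fix \<eta> :: real assume "0 < \<eta>"
    obtain \<delta>1 where \<delta>1: "0 < \<delta>1" "\<And>n \<pi>. partition_of \<delta>1 s t n \<pi> \<Longrightarrow>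
        measure M {\<omega> \<in> space M. norm (S n \<pi> \<omega> - I \<omega>) > e/2} < \<eta>/2"
      using I \<open>0 < e\<close> \<open>0 < \<eta>\<close> unfolding mesh_limit_in_prob_def by (meson half_gt_zero)
    obtain \<delta>2 where \<delta>2: "0 < \<delta>2" "\<And>n \<pi>. partition_of \<delta>2 s t n \<pi> \<Longrightarrow>
        measure M {\<omega> \<in> space M. norm (S n \<pi> \<omega> - J \<omega>) > e/2} < \<eta>/2"
      using J \<open>0 < e\<close> \<open>0 < \<eta>\<close> unfolding mesh_limit_in_prob_def by (meson half_gt_zero)
    obtain n \<pi> where part: "partition_of (min \<delta>1 \<delta>2) s t n \<pi>"
      using partition_of_exists[OF \<open>s \<le> t\<close>] \<delta>1(1) \<delta>2(1) by (metis min_less_iff_conj)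
    have [measurable]: "S n \<pi> \<in> borel_measurable M" by (rule SM[OF part])
    have "measure M {\<omega> \<in> space M. norm (I \<omega> - J \<omega>) > e/2 + e/2} \<le>
      measure M {\<omega> \<in> space M. norm (S n \<pi> \<omega> - I \<omega>) > e/2} + measure M {\<omega> \<in> space M. norm (S n \<pi> \<omega> - J \<omega>) > e/2}"
      by (rule measure_norm_add_le) auto
    also have "\<dots> < \<eta>/2 + \<eta>/2"
      using \<delta>1(2)[OF partition_of_weaken[OF part]] \<delta>2(2)[OF partition_of_weaken[OF part]] by simp
    finally show "measure M {\<omega> \<in> space M. norm (I \<omega> - J \<omega>) > e} \<le> 0 + \<eta>" by simp
  qed
  have "AE \<omega> in M. \<forall>i. norm (I \<omega> - J \<omega>) \<le> inverse (real (Suc i))"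
  proof (rule AE_all_countable[THEN iffD2], rule allI, rule AE_I)
    fix i
    show "{\<omega> \<in> space M. \<not> norm (I \<omega> - J \<omega>) \<le> inverse (real (Suc i))}
        \<subseteq> {\<omega> \<in> space M. norm (I \<omega> - J \<omega>) > inverse (real (Suc i))}"
      by auto
    show "emeasure M {\<omega> \<in> space M. norm (I \<omega> - J \<omega>) > inverse (real (Suc i))} = 0"
      using zero[of "inverse (real (Suc i))"] by (simp add: emeasure_eq_measure)
  qed measurable
  then show ?thesis
  proof eventually_elim
    case (elim \<omega>)
    have "norm (I \<omega> - J \<omega>) \<le> 0"
      by (rule LIMSEQ_le_const[OF LIMSEQ_inverse_real_of_nat]) (use elim in auto)
    then show ?case by simp
  qed
qed

lemma mesh_limit_in_prob_linear:
  fixes S S' :: "nat \<Rightarrow> (nat \<Rightarrow> real) \<Rightarrow> 'w \<Rightarrow> real"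
  assumes "finite_measure M"
    and SM: "\<And>\<delta> n \<pi>. partition_of \<delta> s t n \<pi> \<Longrightarrow> S n \<pi> \<in> borel_measurable M"
    and SM': "\<And>\<delta> n \<pi>. partition_of \<delta> s t n \<pi> \<Longrightarrow> S' n \<pi> \<in> borel_measurable M"
    and I: "mesh_limit_in_prob M S s t I" and J: "mesh_limit_in_prob M S' s t J"
  shows "mesh_limit_in_prob M (\<lambda>n \<pi> \<omega>. c * S n \<pi> \<omega> + d * S' n \<pi> \<omega>) s t (\<lambda>\<omega>. c * I \<omega> + d * J \<omega>)"
  unfolding mesh_limit_in_prob_def
proof (intro conjI allI impI)
  interpret finite_measure M by fact
  have [measurable]: "I \<in> borel_measurable M" "J \<in> borel_measurable M"
    using I J by (auto simp: mesh_limit_in_prob_def)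
  show "(\<lambda>\<omega>. c * I \<omega> + d * J \<omega>) \<in> borel_measurable M" by measurable
  fix e \<eta> :: real assume "0 < e" "0 < \<eta>"
  \<comment> \<open>The added 1 keeps \<open>C\<close> positive when both coefficients vanish;
    \<open>e / (2 * C)\<close> is a tolerance that serves both terms.\<close>
  define C where "C = \<bar>c\<bar> + \<bar>d\<bar> + 1"
  have C: "0 < C" "\<bar>c\<bar> \<le> C" "\<bar>d\<bar> \<le> C"
    by (auto simp: C_def)
  have scale: "e / (2 * C) < norm x" if "e/2 < norm (k * x)" "\<bar>k\<bar> \<le> C" for k x :: real
  proof -
    have "e/2 < C * norm x"
      using that mult_right_mono[OF that(2), of "norm x"] by (simp add: abs_mult)
    then show ?thesis
      using C by (simp add: field_simps)
  qed
  have e': "0 < e / (2 * C)" "0 < \<eta>/2"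
    using \<open>0 < e\<close> C \<open>0 < \<eta>\<close> by auto
  obtain \<delta>1 where \<delta>1: "0 < \<delta>1" "\<And>n \<pi>. partition_of \<delta>1 s t n \<pi> \<Longrightarrow>
      measure M {\<omega> \<in> space M. norm (S n \<pi> \<omega> - I \<omega>) > e / (2 * C)} < \<eta>/2"
    using I e' unfolding mesh_limit_in_prob_def by meson
  obtain \<delta>2 where \<delta>2: "0 < \<delta>2" "\<And>n \<pi>. partition_of \<delta>2 s t n \<pi> \<Longrightarrow>
      measure M {\<omega> \<in> space M. norm (S' n \<pi> \<omega> - J \<omega>) > e / (2 * C)} < \<eta>/2"
    using J e' unfolding mesh_limit_in_prob_def by meson
  have "measure M {\<omega> \<in> space M. norm (c * S n \<pi> \<omega> + d * S' n \<pi> \<omega> - (c * I \<omega> + d * J \<omega>)) > e} < \<eta>"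
    if part: "partition_of (min \<delta>1 \<delta>2) s t n \<pi>" for n \<pi>
  proof -
    have [measurable]: "S n \<pi> \<in> borel_measurable M" "S' n \<pi> \<in> borel_measurable M"
      by (rule SM[OF part], rule SM'[OF part])
    have "measure M {\<omega> \<in> space M. norm (c * S n \<pi> \<omega> + d * S' n \<pi> \<omega> - (c * I \<omega> + d * J \<omega>)) > e/2 + e/2} \<le>
      measure M {\<omega> \<in> space M. norm (c * (S n \<pi> \<omega> - I \<omega>)) > e/2} + measure M {\<omega> \<in> space M. norm (d * (S' n \<pi> \<omega> - J \<omega>)) > e/2}"
    proof (rule measure_norm_add_le)
      show "norm (c * S n \<pi> \<omega> + d * S' n \<pi> \<omega> - (c * I \<omega> + d * J \<omega>))
          \<le> norm (c * (S n \<pi> \<omega> - I \<omega>)) + norm (d * (S' n \<pi> \<omega> - J \<omega>))" for \<omega>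
        using norm_triangle_ineq[of "c * (S n \<pi> \<omega> - I \<omega>)" "d * (S' n \<pi> \<omega> - J \<omega>)"] by (simp add: algebra_simps)
    qed measurable
    also have "measure M {\<omega> \<in> space M. norm (c * (S n \<pi> \<omega> - I \<omega>)) > e/2} \<le>
        measure M {\<omega> \<in> space M. norm (S n \<pi> \<omega> - I \<omega>) > e / (2 * C)}"
      by (rule finite_measure_mono) (use scale C in blast, measurable)
    also have "measure M {\<omega> \<in> space M. norm (d * (S' n \<pi> \<omega> - J \<omega>)) > e/2} \<le>
        measure M {\<omega> \<in> space M. norm (S' n \<pi> \<omega> - J \<omega>) > e / (2 * C)}"
      by (rule finite_measure_mono) (use scale C in blast, measurable)
    finally have "measure M {\<omega> \<in> space M. norm (c * S n \<pi> \<omega> + d * S' n \<pi> \<omega> - (c * I \<omega> + d * J \<omega>)) > e} \<le>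
      measure M {\<omega> \<in> space M. norm (S n \<pi> \<omega> - I \<omega>) > e / (2 * C)} +
      measure M {\<omega> \<in> space M. norm (S' n \<pi> \<omega> - J \<omega>) > e / (2 * C)}"
      by simp
    also have "\<dots> < \<eta>/2 + \<eta>/2"
      using \<delta>1(2)[OF partition_of_weaken[OF part]] \<delta>2(2)[OF partition_of_weaken[OF part]] by simp
    finally show ?thesis by simp
  qed
  then show "\<exists>\<delta>>0. \<forall>n \<pi>. partition_of \<delta> s t n \<pi> \<longrightarrow>
      measure M {\<omega> \<in> space M. norm (c * S n \<pi> \<omega> + d * S' n \<pi> \<omega> - (c * I \<omega> + d * J \<omega>)) > e} < \<eta>"
    using \<delta>1(1) \<delta>2(1) by (intro exI[of _ "min \<delta>1 \<delta>2"]) auto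
qed

section \<open>Existence of backward integrals along a backward diffusion\<close>

text \<open>\<open>refine \<pi> \<rho> k l\<close> is the point \<open>\<rho> l\<close> clamped to \<open>[\<pi> k, \<pi> (k + 1)]\<close>: for each \<open>k\<close> these points
  subdivide that interval, and all cells together form the common refinement of \<open>\<pi>\<close> and \<open>\<rho>\<close>
  (with many degenerate cells).\<close>

definition refine :: "(nat \<Rightarrow> real) \<Rightarrow> (nat \<Rightarrow> real) \<Rightarrow> nat \<Rightarrow> nat \<Rightarrow> real" where
  "refine \<pi> \<rho> k l = max (\<pi> k) (min (\<rho> l) (\<pi> (Suc k)))"

section \<open>Riemann sums on the common refinement\<close>

text \<open>As \<open>l\<close> runs from 0 to \<open>m\<close>, the clamped point moves from the
  left to the right end of the cell of \<pi>, because \<rho> runs from \<open>s\<close> to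
  \<open>t\<close>; the sum telescopes.\<close>

lemma sum_refine_columns:
  fixes F :: "real \<Rightarrow> 'b::ab_group_add"
  assumes \<pi>: "partition_of \<delta> s t n \<pi>" and \<rho>: "partition_of \<delta>' s t m \<rho>" and "k < n"
  shows "(\<Sum>l<m. F (refine \<pi> \<rho> k (Suc l)) - F (refine \<pi> \<rho> k l)) = F (\<pi> (Suc k)) - F (\<pi> k)"
proof -
  have "\<pi> k \<le> \<pi> (Suc k)" "s \<le> \<pi> k" "\<pi> (Suc k) \<le> t"
    using partition_of_mono[OF \<pi>, of k "Suc k"] partition_of_bounds[OF \<pi>] \<open>k < n\<close> by auto
  then have "refine \<pi> \<rho> k 0 = \<pi> k" "refine \<pi> \<rho> k m = \<pi> (Suc k)"
    using \<rho> by (auto simp: refine_def partition_of_def)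
  then show ?thesis
    by (simp only: sum_lessThan_telescope[of "\<lambda>l. F (refine \<pi> \<rho> k l)"])
qed

text \<open>For fixed \<open>l\<close> the terms do not telescope in \<open>k\<close> as they stand.
  With \<open>F (\<pi> k)\<close> subtracted they do: the sum collects the parts of
  \<open>{s..\<rho> l}\<close> inside the successive cells of \<pi> and gives
  \<open>F (\<rho> l) - F s\<close>.\<close>

lemma sum_refine_rows:
  fixes F :: "real \<Rightarrow> 'b::ab_group_add"
  assumes \<pi>: "partition_of \<delta> s t n \<pi>" and \<rho>: "partition_of \<delta>' s t m \<rho>" and "l < m"
  shows "(\<Sum>k<n. F (refine \<pi> \<rho> k (Suc l)) - F (refine \<pi> \<rho> k l)) = F (\<rho> (Suc l)) - F (\<rho> l)"
proof -
  have *: "(\<Sum>k<n. F (refine \<pi> \<rho> k i) - F (\<pi> k)) = F (\<rho> i) - F s" if "i \<le> m" for i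
  proof -
    have i: "s \<le> \<rho> i" "\<rho> i \<le> t"
      using partition_of_bounds[OF \<rho> that] by auto
    \<comment> \<open>The first \<open>j\<close> cells only see what lies below
      \<open>\<pi> j\<close>, hence the minimum in the invariant.\<close>
    have "(\<Sum>k<j. F (refine \<pi> \<rho> k i) - F (\<pi> k)) = F (min (\<rho> i) (\<pi> j)) - F s" if "j \<le> n" for j
      using that
    proof (induction j)
      case 0
      then show ?case
        using \<pi> i by (simp add: partition_of_def min_absorb2)
    next
      case (Suc j)
      then have le: "\<pi> j \<le> \<pi> (Suc j)"
        using \<pi> by (simp add: partition_of_def)
      show ?case
      proof (cases "\<rho> i \<le> \<pi> j")
        case True
        then show ?thesis
          using le Suc by (simp add: refine_def min_absorb1 max_absorb1)
      next
        case False
        then have "min (\<rho> i) (\<pi> j) = \<pi> j" "refine \<pi> \<rho> j i = min (\<rho> i) (\<pi> (Suc j))"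
          using le by (auto simp: refine_def)
        then show ?thesis
          using Suc by simp
      qed
    qed
    from this[OF order_refl] show ?thesis
      using \<pi> i by (simp add: partition_of_def min_absorb1)
  qed
  have "(\<Sum>k<n. F (refine \<pi> \<rho> k (Suc l)) - F (refine \<pi> \<rho> k l)) =
      (\<Sum>k<n. F (refine \<pi> \<rho> k (Suc l)) - F (\<pi> k)) - (\<Sum>k<n. F (refine \<pi> \<rho> k l) - F (\<pi> k))"
    by (simp flip: sum_subtractf)
  then show ?thesis
    using *[of "Suc l"] *[of l] \<open>l < m\<close> by simp
qed

lemma refine_mono:
  assumes "partition_of \<delta> s t m \<rho>" "l \<le> l'" "l' \<le> m"
  shows "refine \<pi> \<rho> k l \<le> refine \<pi> \<rho> k l'"
  using partition_of_mono[OF assms] unfolding refine_def by (intro max.mono min.mono) auto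

text \<open>Both sums are spread over the same cells. A nondegenerate cell lies in one interval of
  each partition, so for fine partitions it compares \<gamma> at two nearby times; degenerate cells
  contribute 0.\<close>

lemma riemann_sum_difference:
  fixes \<gamma> F :: "real \<Rightarrow> 'a::real_inner"
  assumes \<pi>: "partition_of \<delta> s t n \<pi>" and \<rho>: "partition_of \<delta>' s t m \<rho>"
  shows "(\<Sum>k<n. \<gamma> (\<pi> (Suc k)) \<bullet> (F (\<pi> (Suc k)) - F (\<pi> k))) - (\<Sum>l<m. \<gamma> (\<rho> (Suc l)) \<bullet> (F (\<rho> (Suc l)) - F (\<rho> l)))
    = (\<Sum>k<n. \<Sum>l<m. (\<gamma> (\<pi> (Suc k)) - \<gamma> (\<rho> (Suc l))) \<bullet> (F (refine \<pi> \<rho> k (Suc l)) - F (refine \<pi> \<rho> k l)))"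
proof -
  let ?d = "\<lambda>k l. F (refine \<pi> \<rho> k (Suc l)) - F (refine \<pi> \<rho> k l)"
  have "(\<Sum>k<n. \<gamma> (\<pi> (Suc k)) \<bullet> (F (\<pi> (Suc k)) - F (\<pi> k))) = (\<Sum>k<n. \<Sum>l<m. \<gamma> (\<pi> (Suc k)) \<bullet> ?d k l)"
    by (intro sum.cong refl) (simp flip: sum_refine_columns[OF \<pi> \<rho>] inner_sum_right)
  moreover have "(\<Sum>l<m. \<gamma> (\<rho> (Suc l)) \<bullet> (F (\<rho> (Suc l)) - F (\<rho> l))) = (\<Sum>l<m. \<Sum>k<n. \<gamma> (\<rho> (Suc l)) \<bullet> ?d k l)"
    by (intro sum.cong refl) (simp flip: sum_refine_rows[OF \<pi> \<rho>] inner_sum_right)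
  moreover have "\<dots> = (\<Sum>k<n. \<Sum>l<m. \<gamma> (\<rho> (Suc l)) \<bullet> ?d k l)"
    by (rule sum.swap)
  ultimately show ?thesis
    by (simp add: inner_diff_left sum_subtractf)
qed

section \<open>Convergence of the sums along the diffusion\<close>

lemma continuous_on_section:
  assumes "continuous_on (A \<times> UNIV) (\<lambda>(r, x). F r x)" "r \<in> A"
  shows "continuous_on UNIV (F r)"
proof -
  have "continuous_on UNIV (\<lambda>x. case (r, x) of (r, x) \<Rightarrow> F r x)"
    by (rule continuous_on_compose2[OF assms(1)]) (use assms(2) in \<open>auto intro!: continuous_on_Pair continuous_on_id continuous_on_const\<close>)
  then show ?thesis by simp
qed

lemma continuous_on_along_path:
  assumes "continuous_on (A \<times> UNIV) (\<lambda>(r, x). F r x)" "continuous_on B y" "B \<subseteq> A"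
  shows "continuous_on B (\<lambda>r. F r (y r))"
proof -
  have "continuous_on B (\<lambda>r. case (r, y r) of (r, x) \<Rightarrow> F r x)"
    by (rule continuous_on_compose2[OF assms(1)]) (use assms(2,3) in \<open>auto intro!: continuous_on_Pair continuous_on_id\<close>)
  then show ?thesis by simp
qed

lemma backward_sde_integral_exists:
  fixes X W :: "real \<Rightarrow> 'w \<Rightarrow> 'a::euclidean_space"
  assumes sde: "backward_sde_solution M G W a \<sigma> s t X" and "s \<le> t"
    and a: "continuous_on ({s..t} \<times> UNIV) (\<lambda>(r, x). a r x)"
    and \<sigma>: "continuous_on {s..t} \<sigma>"
    and g: "\<And>r. r \<in> {s..t} \<Longrightarrow> g r \<in> borel_measurable (G r)"
    and gcont: "\<And>\<omega>. \<omega> \<in> space M \<Longrightarrow> continuous_on {s..t} (\<lambda>r. g r \<omega>)"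
  shows "\<exists>I. has_backward_integral M (\<bullet>) g X s t I"
proof -
  have bb: "backward_brownian M G s t W"
    and XG: "\<And>r. r \<in> {s..t} \<Longrightarrow> X r \<in> borel_measurable (G r)"
    and Xcont: "\<And>\<omega>. \<omega> \<in> space M \<Longrightarrow> continuous_on {s..t} (\<lambda>r. X r \<omega>)"
    using sde by (auto simp: backward_sde_solution_def)
  interpret prob_space M using bb by (simp add: backward_brownian_def)
  have sub: "subalgebra M (G r)" if "r \<in> {s..t}" for r
    using bb that by (auto simp: backward_brownian_def)
  have sub2: "subalgebra (G r) (G r')" if "s \<le> r" "r \<le> r'" "r' \<le> t" for r r'
    using bb that by (auto simp: backward_brownian_def)
  have gM: "g r \<in> borel_measurable M" if "r \<in> {s..t}" for r
    using measurable_from_subalg[OF sub[OF that] g[OF that]] .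
  have XM: "X r \<in> borel_measurable M" if "r \<in> {s..t}" for r
    using measurable_from_subalg[OF sub[OF that] XG[OF that]] .
  define \<alpha> where "\<alpha> r \<omega> = a r (X r \<omega>)" for r \<omega>
  have \<alpha>M: "\<alpha> r \<in> borel_measurable M" if "r \<in> {s..t}" for r
    unfolding \<alpha>_def[abs_def]
    by (rule borel_measurable_continuous_on[OF continuous_on_section[OF a that] XM[OF that]])
  have \<alpha>cont: "continuous_on {s..t} (\<lambda>r. \<alpha> r \<omega>)" if "\<omega> \<in> space M" for \<omega>
    unfolding \<alpha>_def by (rule continuous_on_along_path[OF a Xcont[OF that] order_refl])
  obtain C where C: "\<And>r. r \<in> {s..t} \<Longrightarrow> \<bar>\<sigma> r\<bar> \<le> C"
    using compact_imp_bounded[OF compact_continuous_image[OF \<sigma> compact_Icc]]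
    by (fastforce simp: bounded_iff)
  have "\<forall>u\<in>{s..t}. \<exists>J. has_backward_integral M (*\<^sub>R) (\<lambda>r _. \<sigma> r) W u t J \<and>
        (AE \<omega> in M. X u \<omega> = X t \<omega> - integral {u..t} (\<lambda>r. \<alpha> r \<omega>) - J \<omega>)"
    using sde by (simp add: backward_sde_solution_def \<alpha>_def)
  \<comment> \<open>\<open>J u\<close> is a fixed version of the noise accumulated between
    \<open>u\<close> and \<open>t\<close>; differences of these versions are the noise
    increments.\<close>
  from bchoice[OF this] obtain J
    where J: "\<And>u. u \<in> {s..t} \<Longrightarrow> has_backward_integral M (*\<^sub>R) (\<lambda>r _. \<sigma> r) W u t (J u)"
      and JX: "\<And>u. u \<in> {s..t} \<Longrightarrow> AE \<omega> in M. X u \<omega> = X t \<omega> - integral {u..t} (\<lambda>r. \<alpha> r \<omega>) - J u \<omega>"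
    by blast
  have JM: "J u \<in> borel_measurable M" if "u \<in> {s..t}" for u
    using J[OF that] by (simp add: has_backward_integral_def mesh_limit_in_prob_def)
  \<comment> \<open>The equations at \<open>u\<close> and \<open>v\<close> are subtracted. The null
    set depends on the pair, which is harmless because two partitions involve finitely many
    cells.\<close>
  have increment: "AE \<omega> in M. X v \<omega> - X u \<omega> = integral {u..v} (\<lambda>r. \<alpha> r \<omega>) + (J u \<omega> - J v \<omega>)"
    if uv: "s \<le> u" "u \<le> v" "v \<le> t" for u v
  proof -
    have "AE \<omega> in M. X u \<omega> = X t \<omega> - integral {u..t} (\<lambda>r. \<alpha> r \<omega>) - J u \<omega>"
      "AE \<omega> in M. X v \<omega> = X t \<omega> - integral {v..t} (\<lambda>r. \<alpha> r \<omega>) - J v \<omega>"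
      using JX uv by auto
    then show ?thesis
      using AE_space
    proof eventually_elim
      case (elim \<omega>)
      have "(\<lambda>r. \<alpha> r \<omega>) integrable_on {u..t}"
        by (rule integrable_continuous_real, rule continuous_on_subset[OF \<alpha>cont[OF elim(3)]]) (use uv in auto)
      from Henstock_Kurzweil_Integration.integral_combine[OF uv(2,3) this] show ?case
        unfolding elim(1,2) by (simp add: algebra_simps)
    qed
  qed
  define S where "S n \<pi> \<omega> = (\<Sum>k<n. g (\<pi> (Suc k)) \<omega> \<bullet> (X (\<pi> (Suc k)) \<omega> - X (\<pi> k) \<omega>))" for n \<pi> \<omega>
  have SM: "S n \<pi> \<in> borel_measurable M" if "partition_of \<delta> s t n \<pi>" for \<delta> n \<pi>
  proof -
    have "\<pi> k \<in> {s..t}" if "k \<le> n" for k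
      using partition_of_bounds[OF \<open>partition_of \<delta> s t n \<pi>\<close> that] by simp
    then show ?thesis
      unfolding S_def by (auto intro!: borel_measurable_sum borel_measurable_inner borel_measurable_diff gM XM)
  qed
  have "\<exists>I. mesh_limit_in_prob M S s t I"
  proof (rule mesh_limit_in_prob_Cauchy[OF finite_measure_axioms \<open>s \<le> t\<close> SM])
    fix e \<eta> :: real assume "0 < e" "0 < \<eta>"
    then have "0 < \<eta> / 4" by simp
    \<comment> \<open>Half of \<eta> is spent on the event where the integrand or the drift is
      large, a quarter on each; the other half is left for the estimates in mean.\<close>
    obtain K1 E1 where K1: "0 < K1" "E1 \<in> sets M" "measure M (space M - E1) < \<eta> / 4"
      "\<And>\<omega> r. \<omega> \<in> E1 \<Longrightarrow> r \<in> {s..t} \<Longrightarrow> norm (g r \<omega>) \<le> K1"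
      by (rule continuous_process_bounded_in_prob[OF finite_measure_axioms gM gcont \<open>0 < \<eta> / 4\<close>]) blast+
    obtain K2 E2 where K2: "0 < K2" "E2 \<in> sets M" "measure M (space M - E2) < \<eta> / 4"
      "\<And>\<omega> r. \<omega> \<in> E2 \<Longrightarrow> r \<in> {s..t} \<Longrightarrow> norm (\<alpha> r \<omega>) \<le> K2"
      by (rule continuous_process_bounded_in_prob[OF finite_measure_axioms \<alpha>M \<alpha>cont \<open>0 < \<eta> / 4\<close>]) blast+
    define K where "K = max K1 K2"
    define E where "E = E1 \<inter> E2"
    have K: "0 < K" and EM: "E \<in> sets M"
      and gK: "\<And>\<omega> r. \<omega> \<in> E \<Longrightarrow> r \<in> {s..t} \<Longrightarrow> norm (g r \<omega>) \<le> K"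
      and \<alpha>K: "\<And>\<omega> r. \<omega> \<in> E \<Longrightarrow> r \<in> {s..t} \<Longrightarrow> norm (\<alpha> r \<omega>) \<le> K"
      using K1 K2 by (auto simp: K_def E_def le_max_iff_disj)
    have "measure M (space M - E) \<le> measure M (space M - E1) + measure M (space M - E2)"
      unfolding E_def Diff_Int using K1 K2 by (intro measure_Un_le) auto
    then have E: "measure M (space M - E) < \<eta> / 2"
      using K1(3) K2(3) by linarith
    \<comment> \<open>Radial projection onto the ball of radius \<open>K\<close>: bounded
      everywhere, still adapted and continuous, and equal to \<open>g\<close> on \<open>E\<close>.
      Moments are taken of \<gamma>, while the sums in \<open>g\<close> are estimated on
      \<open>E\<close> only.\<close>
    define \<gamma> where "\<gamma> r \<omega> = (K / max K (norm (g r \<omega>))) *\<^sub>R g r \<omega>" for r \<omega>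
    have \<gamma>K: "norm (\<gamma> r \<omega>) \<le> K" for r \<omega>
    proof -
      have "K * norm (g r \<omega>) \<le> K * max K (norm (g r \<omega>))"
        using K by (intro mult_left_mono) auto
      then show ?thesis
        using K by (simp add: \<gamma>_def divide_simps less_max_iff_disj)
    qed
    have \<gamma>_eq: "\<gamma> r \<omega> = g r \<omega>" if "\<omega> \<in> E" "r \<in> {s..t}" for r \<omega>
      using gK[OF that] K by (simp add: \<gamma>_def max_absorb1)
    have \<gamma>G: "\<gamma> r \<in> borel_measurable (G r)" if "r \<in> {s..t}" for r
      unfolding \<gamma>_def[abs_def] using g[OF that] by measurable
    have \<gamma>M: "\<gamma> r \<in> borel_measurable M" if "r \<in> {s..t}" for r
      using measurable_from_subalg[OF sub[OF that] \<gamma>G[OF that]] .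
    have \<gamma>cont: "continuous_on {s..t} (\<lambda>r. \<gamma> r \<omega>)" if "\<omega> \<in> space M" for \<omega>
      unfolding \<gamma>_def using gcont[OF that] K by (intro continuous_intros) (auto simp: max_def)
    \<comment> \<open>\<open>B * \<kappa>\<close> is the failure probability reached below. Markov
      for the drift gives the first summand; the noise tail bound, with mean squares at most
      \<open>2 * K * \<kappa>\<close>, gives the second; both scale with the total length
      \<open>t - s\<close> of the cells.\<close>
    define B where "B = (2 * K / e + 4 * DIM('a) * C\<^sup>2 / (e/2)\<^sup>2 * (2 * K)) * (t - s)"
    have B: "0 \<le> B"
      using K \<open>0 < e\<close> \<open>s \<le> t\<close> by (auto simp: B_def)
    define \<kappa> where "\<kappa> = \<eta> / (4 * (B + 1))"
    have \<kappa>: "0 < \<kappa>" "B * \<kappa> < \<eta> / 2"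
    proof -
      show "0 < \<kappa>"
        using B \<open>0 < \<eta>\<close> by (simp add: \<kappa>_def)
      have "B * \<kappa> = \<eta> / 4 - \<kappa>"
        using B by (simp add: \<kappa>_def field_simps)
      then show "B * \<kappa> < \<eta> / 2"
        using \<open>0 < \<kappa>\<close> \<open>0 < \<eta>\<close> by linarith
    qed
    obtain \<delta> where \<delta>: "0 < \<delta>" "\<And>u v. u \<in> {s..t} \<Longrightarrow> v \<in> {s..t} \<Longrightarrow> \<bar>u - v\<bar> < \<delta> \<Longrightarrow>
        (\<integral>\<omega>. norm (\<gamma> u \<omega> - \<gamma> v \<omega>) \<partial>M) < \<kappa>"
      by (rule bounded_continuous_process_L1_uniform[OF finite_measure_axioms \<gamma>M \<gamma>cont \<gamma>K \<kappa>(1)]) blast+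
    have "measure M {\<omega> \<in> space M. \<bar>S n \<pi> \<omega> - S m \<rho> \<omega>\<bar> > e} < \<eta>"
      if \<pi>: "partition_of \<delta> s t n \<pi>" and \<rho>: "partition_of \<delta> s t m \<rho>" for n \<pi> m \<rho>
    proof -
      let ?A = "{..<n} \<times> {..<m}"
      define u v p q where "u = (\<lambda>(k, l). refine \<pi> \<rho> k l)" and "v = (\<lambda>(k, l). refine \<pi> \<rho> k (Suc l))"
        and "p = (\<lambda>(k, l :: nat). \<pi> (Suc k))" and "q = (\<lambda>(k :: nat, l). \<rho> (Suc l))"
      \<comment> \<open>The weight is cut off on degenerate cells: there \<open>q x\<close> may lie
        to the left of \<open>v x\<close>, so that \<gamma> at \<open>q x\<close> need not be known
        at \<open>v x\<close>, and \<open>p x\<close> and \<open>q x\<close> may be far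
        apart.\<close>
      define H where "H x \<omega> = (if u x < v x then \<gamma> (p x) \<omega> - \<gamma> (q x) \<omega> else 0)" for x \<omega>
      have uv: "s \<le> u x \<and> u x \<le> v x \<and> v x \<le> t" and pq: "p x \<in> {s..t}" "q x \<in> {s..t}" and vp: "v x \<le> p x"
        and vq: "u x < v x \<Longrightarrow> v x \<le> q x" and near: "u x < v x \<Longrightarrow> \<bar>p x - q x\<bar> < \<delta>" if xA: "x \<in> ?A" for x
      proof -
        obtain k l where x: "x = (k, l)" and kl: "k < n" "l < m"
          using xA by auto
        have 1: "\<pi> k \<le> \<pi> (Suc k)" "s \<le> \<pi> k" "\<pi> (Suc k) \<le> t" "s \<le> \<pi> (Suc k)" "\<pi> (Suc k) - \<pi> k < \<delta>"
          using \<pi> partition_of_bounds[OF \<pi>, of k] partition_of_bounds[OF \<pi>, of "Suc k"] kl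
          by (auto simp: partition_of_def)
        have 2: "\<rho> l \<le> \<rho> (Suc l)" "s \<le> \<rho> (Suc l)" "\<rho> (Suc l) \<le> t" "\<rho> (Suc l) - \<rho> l < \<delta>"
          using \<rho> partition_of_bounds[OF \<rho>, of "Suc l"] kl by (auto simp: partition_of_def)
        show "s \<le> u x \<and> u x \<le> v x \<and> v x \<le> t" "p x \<in> {s..t}" "q x \<in> {s..t}" "v x \<le> p x"
          "u x < v x \<Longrightarrow> v x \<le> q x" "u x < v x \<Longrightarrow> \<bar>p x - q x\<bar> < \<delta>"
          using 1 2 unfolding x u_def v_def p_def q_def refine_def by (auto simp: max_def min_def split: if_splits)
      qed
      have disj: "v x \<le> u y \<or> v y \<le> u x" if xy: "x \<in> ?A" "y \<in> ?A" "x \<noteq> y" for x y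
      proof -
        obtain k l k' l' where x: "x = (k, l)" "y = (k', l')" and kl: "k < n" "l < m" "k' < n" "l' < m"
          using xy by auto
        have le: "refine \<pi> \<rho> i (Suc j) \<le> refine \<pi> \<rho> i' j'" if "i < i'" "i' < n" for i i' j j'
        proof -
          have "refine \<pi> \<rho> i (Suc j) \<le> \<pi> (Suc i)"
            using \<pi> that by (auto simp: refine_def partition_of_def)
          also have "\<dots> \<le> \<pi> i'"
            using partition_of_mono[OF \<pi>, of "Suc i" i'] that by simp
          also have "\<dots> \<le> refine \<pi> \<rho> i' j'"
            by (simp add: refine_def)
          finally show ?thesis .
        qed
        consider "k < k'" | "k' < k" | "k = k'" "l < l'" | "k = k'" "l' < l"
          using xy x by fastforce
        then show ?thesis
        proof cases
          case 3
          then show ?thesis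
            using refine_mono[OF \<rho>, of "Suc l" l'] kl by (simp add: x u_def v_def)
        next
          case 4
          then show ?thesis
            using refine_mono[OF \<rho>, of "Suc l'" l] kl by (simp add: x u_def v_def)
        qed (use le kl in \<open>auto simp: x u_def v_def\<close>)
      qed
      have HG: "H x \<in> borel_measurable (G (v x))" if "x \<in> ?A" for x
      proof (cases "u x < v x")
        case True
        have "\<gamma> (p x) \<in> borel_measurable (G (v x))" "\<gamma> (q x) \<in> borel_measurable (G (v x))"
          using measurable_from_subalg[OF sub2 \<gamma>G[OF pq(1)[OF that]], of "v x"]
            measurable_from_subalg[OF sub2 \<gamma>G[OF pq(2)[OF that]], of "v x"]
            uv[OF that] pq[OF that] vp[OF that] vq[OF that True] by auto
        then show ?thesis
          using True by (simp add: H_def[abs_def])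
      qed (simp add: H_def[abs_def])
      have H2K: "norm (H x \<omega>) \<le> 2 * K" for x \<omega>
        using norm_triangle_ineq4[of "\<gamma> (p x) \<omega>" "\<gamma> (q x) \<omega>"] \<gamma>K[of "p x" \<omega>] \<gamma>K[of "q x" \<omega>] K by (auto simp: H_def)
      have HM: "H x \<in> borel_measurable M" if "x \<in> ?A" for x
        using measurable_from_subalg[OF sub HG[OF that]] uv[OF that] by auto
      have intH: "integrable M (\<lambda>\<omega>. norm (H x \<omega>))" if "x \<in> ?A" for x
        by (rule integrable_const_bound[where B = "2 * K"]) (use H2K HM[OF that] in auto)
      have EH: "(\<integral>\<omega>. norm (H x \<omega>) \<partial>M) \<le> \<kappa>" if "x \<in> ?A" for x
        using \<delta>(2)[OF pq[OF that] near[OF that]] \<kappa> by (cases "u x < v x") (auto simp: H_def)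
      \<comment> \<open>The bound \<open>2 * K\<close> turns smallness in mean into smallness in
        mean square.\<close>
      have EH2: "(\<integral>\<omega>. (norm (H x \<omega>))\<^sup>2 \<partial>M) \<le> 2 * K * \<kappa>" if "x \<in> ?A" for x
      proof -
        have "(\<integral>\<omega>. (norm (H x \<omega>))\<^sup>2 \<partial>M) \<le> (\<integral>\<omega>. 2 * K * norm (H x \<omega>) \<partial>M)"
        proof (rule integral_mono)
          show "integrable M (\<lambda>\<omega>. (norm (H x \<omega>))\<^sup>2)"
          proof (rule integrable_const_bound)
            have "(norm (H x \<omega>))\<^sup>2 \<le> (2 * K)\<^sup>2" for \<omega>
              by (rule power_mono[OF H2K]) simp
            then show "AE \<omega> in M. norm ((norm (H x \<omega>))\<^sup>2) \<le> (2 * K)\<^sup>2"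
              by (intro AE_I2) simp
          qed (use HM[OF that] in simp)
          show "(norm (H x \<omega>))\<^sup>2 \<le> 2 * K * norm (H x \<omega>)" for \<omega>
            using H2K[of x \<omega>] by (simp add: power2_eq_square mult_right_mono)
        qed (use intH[OF that] in simp)
        also have "\<dots> \<le> 2 * K * \<kappa>"
          using EH[OF that] K by simp
        finally show ?thesis .
      qed
      have length: "(\<Sum>x\<in>?A. v x - u x) = t - s"
      proof -
        have "(\<Sum>x\<in>?A. v x - u x) = (\<Sum>k<n. \<Sum>l<m. refine \<pi> \<rho> k (Suc l) - refine \<pi> \<rho> k l)"
          by (simp add: sum.cartesian_product u_def v_def case_prod_unfold)
        also have "\<dots> = (\<Sum>k<n. \<pi> (Suc k) - \<pi> k)"
          by (intro sum.cong refl) (use sum_refine_columns[OF \<pi> \<rho>, of _ "\<lambda>x. x"] in auto)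
        also have "\<dots> = t - s"
          using \<pi> by (simp add: sum_lessThan_telescope partition_of_def)
        finally show ?thesis .
      qed
      define D where "D x \<omega> = J (u x) \<omega> - J (v x) \<omega>" for x \<omega>
      have Dlim: "mesh_limit_in_prob M (\<lambda>n \<pi> \<omega>. \<Sum>k<n. \<sigma> (\<pi> (Suc k)) *\<^sub>R (W (\<pi> (Suc k)) \<omega> - W (\<pi> k) \<omega>))
          (u x) (v x) (D x)" if "x \<in> ?A" for x
      proof -
        have "u x \<in> {s..t}" "v x \<in> {s..t}" "u x \<le> v x" "v x \<le> t"
          using uv[OF that] by auto
        then show ?thesis
          unfolding D_def by (intro backward_integral_subinterval[OF finite_measure_axioms _ _ J J])
      qed
      define P where "P = {\<omega> \<in> space M. \<bar>\<Sum>x\<in>?A. H x \<omega> \<bullet> D x \<omega>\<bar> > e/2}"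
      have DM: "D x \<in> borel_measurable M" if "x \<in> ?A" for x
        unfolding D_def using uv[OF that] by (auto intro!: borel_measurable_diff JM)
      have PM: "P \<in> sets M"
      proof -
        have [measurable]: "(\<lambda>\<omega>. \<Sum>x\<in>?A. H x \<omega> \<bullet> D x \<omega>) \<in> borel_measurable M"
          using HM DM by (intro borel_measurable_sum borel_measurable_inner) auto
        show ?thesis unfolding P_def by measurable
      qed
      have P: "measure M P \<le> 4 * DIM('a) * C\<^sup>2 / (e/2)\<^sup>2 * ((t - s) * (2 * K * \<kappa>))"
      proof -
        have "measure M P \<le> 4 * DIM('a) * C\<^sup>2 / (e/2)\<^sup>2 * (\<Sum>x\<in>?A. (v x - u x) * (\<integral>\<omega>. (norm (H x \<omega>))\<^sup>2 \<partial>M))"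
          unfolding P_def
        proof (rule wiener_increments_tail_bound[OF bb])
          show "s \<le> u x \<and> u x \<le> v x \<and> v x \<le> t" if "x \<in> ?A" for x
            by (rule uv[OF that])
          show "v x \<le> u y \<or> v y \<le> u x" if "x \<in> ?A" "y \<in> ?A" "x \<noteq> y" for x y
            by (rule disj[OF that])
          show "H x \<in> borel_measurable (G (v x))" if "x \<in> ?A" for x
            by (rule HG[OF that])
          show "mesh_limit_in_prob M (\<lambda>n \<pi> \<omega>. \<Sum>k<n. \<sigma> (\<pi> (Suc k)) *\<^sub>R (W (\<pi> (Suc k)) \<omega> - W (\<pi> k) \<omega>))
              (u x) (v x) (D x)" if "x \<in> ?A" for x
            by (rule Dlim[OF that])
          show "norm (H x \<omega>) \<le> 2 * K" for x \<omega>
            by (rule H2K)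
        qed (use C \<open>0 < e\<close> in auto)
        also have "\<dots> \<le> 4 * DIM('a) * C\<^sup>2 / (e/2)\<^sup>2 * (\<Sum>x\<in>?A. (v x - u x) * (2 * K * \<kappa>))"
          using EH2 uv by (intro mult_left_mono sum_mono) auto
        finally show ?thesis
          by (simp add: sum_distrib_right[symmetric] length)
      qed
      \<comment> \<open>On \<open>E\<close> the drift is at most \<open>K\<close>, so
        \<open>Q\<close> dominates its share of the difference there; built from the truncated
        integrand, \<open>Q\<close> has a small expectation over the whole space.\<close>
      define Q where "Q \<omega> = K * (\<Sum>x\<in>?A. (v x - u x) * norm (H x \<omega>))" for \<omega>
      have intQ: "integrable M Q"
        unfolding Q_def using intH by (auto intro!: Bochner_Integration.integrable_sum)
      have "(\<integral>\<omega>. Q \<omega> \<partial>M) = K * (\<Sum>x\<in>?A. (v x - u x) * (\<integral>\<omega>. norm (H x \<omega>) \<partial>M))"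
        unfolding Q_def using intH by (simp add: Bochner_Integration.integral_sum)
      also have "\<dots> \<le> K * (\<Sum>x\<in>?A. (v x - u x) * \<kappa>)"
        using EH uv K by (intro mult_left_mono sum_mono) auto
      finally have EQ: "(\<integral>\<omega>. Q \<omega> \<partial>M) \<le> K * ((t - s) * \<kappa>)"
        by (simp add: sum_distrib_right[symmetric] length)
      have Q0: "0 \<le> Q \<omega>" for \<omega>
        unfolding Q_def using K uv by (intro mult_nonneg_nonneg sum_nonneg) auto
      have "measure M {\<omega> \<in> space M. Q \<omega> \<ge> e/2} \<le> (\<integral>\<omega>. Q \<omega> \<partial>M) / (e/2)"
        by (rule integral_Markov_inequality_measure[OF intQ, of "{}"]) (use Q0 \<open>0 < e\<close> in auto)
      also have "\<dots> \<le> K * ((t - s) * \<kappa>) / (e/2)"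
        using EQ \<open>0 < e\<close> by (intro divide_right_mono) auto
      finally have Qe: "measure M {\<omega> \<in> space M. Q \<omega> \<ge> e/2} \<le> K * ((t - s) * \<kappa>) / (e/2)" .
      have "AE \<omega> in M. \<forall>x\<in>?A. X (v x) \<omega> - X (u x) \<omega> = integral {u x..v x} (\<lambda>r. \<alpha> r \<omega>) + D x \<omega>"
        unfolding D_def by (rule AE_finite_allI) (use uv in \<open>auto intro!: increment\<close>)
      then have "AE \<omega> in M. \<omega> \<in> {\<omega> \<in> space M. \<bar>S n \<pi> \<omega> - S m \<rho> \<omega>\<bar> > e} \<longrightarrow>
          \<omega> \<in> (space M - E) \<union> ({\<omega> \<in> space M. Q \<omega> \<ge> e/2} \<union> P)"
      proof eventually_elim
        case (elim \<omega>)
        have "\<bar>S n \<pi> \<omega> - S m \<rho> \<omega>\<bar> \<le> e" if \<omega>: "\<omega> \<in> space M" "\<omega> \<in> E" "Q \<omega> < e/2" "\<omega> \<notin> P"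
        proof -
          have "S n \<pi> \<omega> - S m \<rho> \<omega> = (\<Sum>k<n. \<Sum>l<m. (g (\<pi> (Suc k)) \<omega> - g (\<rho> (Suc l)) \<omega>) \<bullet>
              (X (refine \<pi> \<rho> k (Suc l)) \<omega> - X (refine \<pi> \<rho> k l) \<omega>))"
            unfolding S_def by (rule riemann_sum_difference[OF \<pi> \<rho>])
          also have "\<dots> = (\<Sum>x\<in>?A. (g (p x) \<omega> - g (q x) \<omega>) \<bullet> (X (v x) \<omega> - X (u x) \<omega>))"
            by (simp add: sum.cartesian_product u_def v_def p_def q_def case_prod_unfold)
          also have "\<dots> = (\<Sum>x\<in>?A. H x \<omega> \<bullet> (integral {u x..v x} (\<lambda>r. \<alpha> r \<omega>) + D x \<omega>))"
          proof (rule sum.cong[OF refl])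
            fix x assume x: "x \<in> ?A"
            show "(g (p x) \<omega> - g (q x) \<omega>) \<bullet> (X (v x) \<omega> - X (u x) \<omega>) =
                H x \<omega> \<bullet> (integral {u x..v x} (\<lambda>r. \<alpha> r \<omega>) + D x \<omega>)"
            proof (cases "u x < v x")
              case True
              then show ?thesis
                using bspec[OF elim x] \<gamma>_eq[OF \<omega>(2)] pq[OF x] by (simp add: H_def)
            next
              case False
              then have "u x = v x"
                using uv[OF x] by simp
              then show ?thesis
                by (simp add: H_def)
            qed
          qed
          also have "\<dots> = (\<Sum>x\<in>?A. H x \<omega> \<bullet> integral {u x..v x} (\<lambda>r. \<alpha> r \<omega>)) + (\<Sum>x\<in>?A. H x \<omega> \<bullet> D x \<omega>)"
            by (simp add: inner_add_right sum.distrib)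
          finally have split: "S n \<pi> \<omega> - S m \<rho> \<omega> = \<dots>" .
          have "\<bar>\<Sum>x\<in>?A. H x \<omega> \<bullet> integral {u x..v x} (\<lambda>r. \<alpha> r \<omega>)\<bar> \<le> (\<Sum>x\<in>?A. K * ((v x - u x) * norm (H x \<omega>)))"
          proof (rule order_trans[OF sum_abs sum_mono])
            fix x assume x: "x \<in> ?A"
            have "norm (integral {u x..v x} (\<lambda>r. \<alpha> r \<omega>)) \<le> K * (v x - u x)"
            proof (rule integral_bound)
              show "continuous_on {u x..v x} (\<lambda>r. \<alpha> r \<omega>)"
                by (rule continuous_on_subset[OF \<alpha>cont[OF \<omega>(1)]]) (use uv[OF x] in auto)
            qed (use uv[OF x] \<alpha>K[OF \<omega>(2)] in auto)
            then have "norm (H x \<omega>) * norm (integral {u x..v x} (\<lambda>r. \<alpha> r \<omega>)) \<le> norm (H x \<omega>) * (K * (v x - u x))"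
              by (rule mult_left_mono) simp
            with Cauchy_Schwarz_ineq2[of "H x \<omega>" "integral {u x..v x} (\<lambda>r. \<alpha> r \<omega>)"]
            show "\<bar>H x \<omega> \<bullet> integral {u x..v x} (\<lambda>r. \<alpha> r \<omega>)\<bar> \<le> K * ((v x - u x) * norm (H x \<omega>))"
              by (simp add: mult_ac)
          qed
          also have "\<dots> = Q \<omega>"
            by (simp add: Q_def sum_distrib_left)
          finally have "\<bar>\<Sum>x\<in>?A. H x \<omega> \<bullet> integral {u x..v x} (\<lambda>r. \<alpha> r \<omega>)\<bar> \<le> Q \<omega>" .
          moreover have "\<bar>\<Sum>x\<in>?A. H x \<omega> \<bullet> D x \<omega>\<bar> \<le> e/2"
            using \<omega> unfolding P_def by auto
          ultimately show ?thesis
            unfolding split using \<omega>(3) by linarith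
        qed
        then show ?case by force
      qed
      then have "measure M {\<omega> \<in> space M. \<bar>S n \<pi> \<omega> - S m \<rho> \<omega>\<bar> > e} \<le>
          measure M ((space M - E) \<union> ({\<omega> \<in> space M. Q \<omega> \<ge> e/2} \<union> P))"
        by (rule finite_measure_mono_AE) (use EM PM borel_measurable_integrable[OF intQ] in measurable)
      also have "\<dots> \<le> measure M (space M - E) + measure M ({\<omega> \<in> space M. Q \<omega> \<ge> e/2} \<union> P)"
        by (rule measure_Un_le) (use EM PM borel_measurable_integrable[OF intQ] in measurable)
      also have "measure M ({\<omega> \<in> space M. Q \<omega> \<ge> e/2} \<union> P) \<le> measure M {\<omega> \<in> space M. Q \<omega> \<ge> e/2} + measure M P"
        by (rule measure_Un_le) (use PM borel_measurable_integrable[OF intQ] in measurable)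
      also have "\<dots> \<le> B * \<kappa>"
        using P Qe by (simp add: B_def field_simps)
      finally show ?thesis
        using E \<kappa>(2) by linarith
    qed
    then show "\<exists>\<delta>>0. \<forall>n \<pi> m \<rho>. partition_of \<delta> s t n \<pi> \<longrightarrow> partition_of \<delta> s t m \<rho> \<longrightarrow>
      measure M {\<omega> \<in> space M. \<bar>S n \<pi> \<omega> - S m \<rho> \<omega>\<bar> > e} < \<eta>"
      using \<delta>(1) by blast
  qed
  then show ?thesis
    unfolding has_backward_integral_def S_def[abs_def] using gM XM by blast
qed

section \<open>The guidance weight\<close>

lemma has_backward_integral_linear:
  fixes Y :: "real \<Rightarrow> 'w \<Rightarrow> 'a::euclidean_space"
  assumes "finite_measure M" "s \<le> t"
    and I: "has_backward_integral M (\<bullet>) g Y s t I" and J: "has_backward_integral M (\<bullet>) h Y s t J"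
  shows "has_backward_integral M (\<bullet>) (\<lambda>u \<omega>. c *\<^sub>R g u \<omega> + d *\<^sub>R h u \<omega>) Y s t (\<lambda>\<omega>. c * I \<omega> + d * J \<omega>)"
proof -
  have meas: "g r \<in> borel_measurable M" "h r \<in> borel_measurable M" "Y r \<in> borel_measurable M" if "r \<in> {s..t}" for r
    using I J that by (auto simp: has_backward_integral_def)
  have SM: "(\<lambda>\<omega>. \<Sum>k<n. q (\<pi> (Suc k)) \<omega> \<bullet> (Y (\<pi> (Suc k)) \<omega> - Y (\<pi> k) \<omega>)) \<in> borel_measurable M"
    if \<pi>: "partition_of \<delta> s t n \<pi>" and q: "\<And>r. r \<in> {s..t} \<Longrightarrow> q r \<in> borel_measurable M" for \<delta> n \<pi> q
  proof -
    have "\<pi> k \<in> {s..t}" if "k \<le> n" for k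
      using partition_of_bounds[OF \<pi> that] by simp
    then show ?thesis
      by (auto intro!: borel_measurable_sum borel_measurable_inner borel_measurable_diff meas q)
  qed
  have "mesh_limit_in_prob M (\<lambda>n \<pi> \<omega>.
      c * (\<Sum>k<n. g (\<pi> (Suc k)) \<omega> \<bullet> (Y (\<pi> (Suc k)) \<omega> - Y (\<pi> k) \<omega>)) +
      d * (\<Sum>k<n. h (\<pi> (Suc k)) \<omega> \<bullet> (Y (\<pi> (Suc k)) \<omega> - Y (\<pi> k) \<omega>))) s t (\<lambda>\<omega>. c * I \<omega> + d * J \<omega>)"
    using I J by (intro mesh_limit_in_prob_linear[OF assms(1)] SM meas)
      (auto simp: has_backward_integral_def)
  then show ?thesis
    unfolding has_backward_integral_def using meas
    by (auto simp: inner_add_left sum.distrib sum_distrib_left)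
qed

lemma has_backward_integral_unique:
  fixes Y :: "real \<Rightarrow> 'w \<Rightarrow> 'a::euclidean_space"
  assumes "finite_measure M" "s \<le> t"
    and I: "has_backward_integral M (\<bullet>) g Y s t I" and J: "has_backward_integral M (\<bullet>) g Y s t J"
  shows "AE \<omega> in M. I \<omega> = J \<omega>"
proof (rule mesh_limit_in_prob_unique[OF assms(1,2)])
  show "(\<lambda>\<omega>. \<Sum>k<n. g (\<pi> (Suc k)) \<omega> \<bullet> (Y (\<pi> (Suc k)) \<omega> - Y (\<pi> k) \<omega>)) \<in> borel_measurable M"
    if \<pi>: "partition_of \<delta> s t n \<pi>" for \<delta> n \<pi>
  proof -
    have "\<pi> k \<in> {s..t}" if "k \<le> n" for k
      using partition_of_bounds[OF \<pi> that] by simp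
    then show ?thesis
      using I by (auto simp: has_backward_integral_def intro!: borel_measurable_sum borel_measurable_inner borel_measurable_diff)
  qed
qed (use I J in \<open>auto simp: has_backward_integral_def\<close>)

text \<open>The chosen integral of the combination and the combination of the chosen integrals are
  limits of the same sums, so uniqueness applies. Existence for \<open>g\<close> and
  \<open>h\<close> makes their choices genuine integrals and yields existence for the
  combination.\<close>

lemma backward_integral_linear:
  fixes Y :: "real \<Rightarrow> 'w \<Rightarrow> 'a::euclidean_space"
  assumes M: "finite_measure M" "s \<le> t"
    and g: "\<exists>I. has_backward_integral M (\<bullet>) g Y s t I" and h: "\<exists>I. has_backward_integral M (\<bullet>) h Y s t I"
  shows "AE \<omega> in M. backward_integral M (\<lambda>u \<omega>. c *\<^sub>R g u \<omega> + d *\<^sub>R h u \<omega>) Y s t \<omega> =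
    c * backward_integral M g Y s t \<omega> + d * backward_integral M h Y s t \<omega>"
proof (rule has_backward_integral_unique[OF M])
  show lin: "has_backward_integral M (\<bullet>) (\<lambda>u \<omega>. c *\<^sub>R g u \<omega> + d *\<^sub>R h u \<omega>) Y s t
      (\<lambda>\<omega>. c * backward_integral M g Y s t \<omega> + d * backward_integral M h Y s t \<omega>)"
    using someI_ex[OF g] someI_ex[OF h] unfolding backward_integral_def
    by (rule has_backward_integral_linear[OF M])
  from someI_ex[OF exI, of "has_backward_integral M (\<bullet>) (\<lambda>u \<omega>. c *\<^sub>R g u \<omega> + d *\<^sub>R h u \<omega>) Y s t", OF lin]
  show "has_backward_integral M (\<bullet>) (\<lambda>u \<omega>. c *\<^sub>R g u \<omega> + d *\<^sub>R h u \<omega>) Y s t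
      (backward_integral M (\<lambda>u \<omega>. c *\<^sub>R g u \<omega> + d *\<^sub>R h u \<omega>) Y s t)"
    unfolding backward_integral_def .
qed

text \<open>Serves the weight over a final piece of the time interval. Everything is anchored at the
  right end: the normalisation of the Brownian motion and the integrals up to \<open>t\<close> are
  the same on the shorter interval.\<close>

lemma backward_sde_solution_subinterval:
  fixes X W :: "real \<Rightarrow> 'w \<Rightarrow> 'a::euclidean_space"
  assumes sde: "backward_sde_solution M G W a \<sigma> s t X" and "s \<le> s'"
  shows "backward_sde_solution M G W a \<sigma> s' t X"
proof -
  have sub: "{s'..t} \<subseteq> {s..t}"
    using \<open>s \<le> s'\<close> by auto
  have "backward_brownian M G s t W"
    using sde by (simp add: backward_sde_solution_def)
  then have "backward_brownian M G s' t W"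
    unfolding backward_brownian_def using sub
    by (auto intro: continuous_on_subset)
  moreover have "AE \<omega> in M. (\<lambda>r. a r (X r \<omega>)) absolutely_integrable_on {s..t}"
    using sde by (simp add: backward_sde_solution_def)
  then have "AE \<omega> in M. (\<lambda>r. a r (X r \<omega>)) absolutely_integrable_on {s'..t}"
    by eventually_elim (rule absolutely_integrable_on_subinterval[OF _ sub])
  ultimately show ?thesis
    using sde sub unfolding backward_sde_solution_def by (auto intro: continuous_on_subset)
qed

section \<open>The quadratic identity and the guidance weight\<close>

text \<open>Completing the square leaves twice the inner product of \<open>x\<close> and
  \<open>v\<close> minus \<open>c\<close> times the squared norm of \<open>v\<close>. The inner
  products are linear in \<open>v\<close> and cancel against the mixture of \<open>y\<close> and
  \<open>z\<close>; what remains is the defect of the squared norm from being affine, which is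
  \<open>\<beta> * (1 - \<beta>)\<close> times the squared distance of \<open>y\<close> and
  \<open>z\<close>.\<close>

lemma guidance_energy:
  fixes x y z :: "'a::real_inner"
  assumes "c \<noteq> 0"
  shows "(1 - \<beta>) * (1/2 * (1 / c * ((norm x)\<^sup>2 - (norm (x - c *\<^sub>R y))\<^sup>2)))
      + \<beta> * (1/2 * (1 / c * ((norm x)\<^sup>2 - (norm (x - c *\<^sub>R z))\<^sup>2)))
      - 1/2 * (1 / c * ((norm x)\<^sup>2 - (norm (x - c *\<^sub>R ((1 - \<beta>) *\<^sub>R y + \<beta> *\<^sub>R z)))\<^sup>2))
    = c / 2 * \<beta> * (\<beta> - 1) * (norm (y - z))\<^sup>2"
proof -
  have *: "1 / c * ((norm x)\<^sup>2 - (norm (x - c *\<^sub>R v))\<^sup>2) = 2 * (x \<bullet> v) - c * (v \<bullet> v)" for v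
    using assms by (simp add: power2_norm_eq_inner inner_diff inner_commute field_simps)
  show ?thesis
    unfolding *
    unfolding power2_norm_eq_inner
    by (simp add: inner_add inner_diff inner_commute field_simps)
qed

theorem propositionH5:
  fixes f a b :: "real \<Rightarrow> 'a::euclidean_space \<Rightarrow> 'a"
    and p1 p2 :: "real \<Rightarrow> 'a \<Rightarrow> real"
    and \<sigma> \<epsilon> :: "real \<Rightarrow> real"
    and \<beta> \<tau> \<tau>' T :: real
    and N1 :: "'w1 measure" and F1 :: "real \<Rightarrow> 'w1 measure" and W1 Y1 :: "real \<Rightarrow> 'w1 \<Rightarrow> 'a"
    and N2 :: "'w2 measure" and F2 :: "real \<Rightarrow> 'w2 measure" and W2 Y2 :: "real \<Rightarrow> 'w2 \<Rightarrow> 'a"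
    and M :: "'w measure" and G :: "real \<Rightarrow> 'w measure" and W X :: "real \<Rightarrow> 'w \<Rightarrow> 'a"
    and w :: "real \<Rightarrow> 'w \<Rightarrow> real"
  assumes times: "0 \<le> \<tau>" "\<tau> < \<tau>'" "\<tau>' \<le> T"
    and model1: "forward_sde_solution N1 F1 W1 f \<sigma> 0 T Y1"
    and marginals1: "\<And>t. t \<in> {\<tau>..\<tau>'} \<Longrightarrow> distributed N1 lborel (Y1 t) (\<lambda>x. ennreal (p1 t x))"
    and model2: "forward_sde_solution N2 F2 W2 f \<sigma> 0 T Y2"
    and marginals2: "\<And>t. t \<in> {\<tau>..\<tau>'} \<Longrightarrow> distributed N2 lborel (Y2 t) (\<lambda>x. ennreal (p2 t x))"
    and sigma_pos: "\<And>t. t \<in> {\<tau>..\<tau>'} \<Longrightarrow> 0 < \<sigma> t"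
    and sigma_cont: "continuous_on {\<tau>..\<tau>'} \<sigma>"
    and f_smooth: "smooth_drift \<tau> \<tau>' f"
    and p_smooth: "smooth_log_density \<tau> \<tau>' p1" "smooth_log_density \<tau> \<tau>' p2"
    and a_choice: "a = (\<lambda>t x. f t x - (\<sigma> t)\<^sup>2 *\<^sub>R ((1 - \<beta>) *\<^sub>R score p1 t x + \<beta> *\<^sub>R score p2 t x))"
    and b_choice: "b = f"
    and eps_choice: "\<epsilon> = \<sigma>"
    and sampling: "backward_sde_solution M G W a \<epsilon> \<tau> \<tau>' X"
    and initial: "distributed M lborel (X \<tau>') (\<lambda>x. ennreal (cfg_target p1 p2 \<beta> \<tau>' x))"
    and weight: "w = (\<lambda>t. cfg_weight M \<epsilon> \<beta> (reversal_drift f \<sigma> p1) f (reversal_drift f \<sigma> p2) f a b X t \<tau>')"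
  shows "backward_sde_solution M G W
           (\<lambda>t x. f t x - ((1 - \<beta>) * (\<sigma> t)\<^sup>2) *\<^sub>R score p1 t x - (\<beta> * (\<sigma> t)\<^sup>2) *\<^sub>R score p2 t x)
           \<sigma> \<tau> \<tau>' X
       \<and> (\<forall>t\<in>{\<tau>..\<tau>'}. AE \<omega> in M.
            ln (w t \<omega>) = - integral {t..\<tau>'} (\<lambda>u. - ((\<sigma> u)\<^sup>2 / 2) * \<beta> * (\<beta> - 1)
                            * (norm (score p1 u (X u \<omega>) - score p2 u (X u \<omega>)))\<^sup>2))
       \<and> (\<exists>L. (\<forall>t\<in>{\<tau>..\<tau>'}. AE \<omega> in M. L t \<omega> = ln (w t \<omega>))
            \<and> (AE \<omega> in M. L \<tau>' \<omega> = 0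
                \<and> (\<forall>t\<in>{\<tau>..\<tau>'}. ((\<lambda>u. L u \<omega>) has_real_derivative
                     - ((\<sigma> t)\<^sup>2 / 2) * \<beta> * (\<beta> - 1)
                       * (norm (score p1 t (X t \<omega>) - score p2 t (X t \<omega>)))\<^sup>2)
                     (at t within {\<tau>..\<tau>'}))))"
proof (intro conjI)
  \<comment> \<open>\<psi> is the coefficient of the differential equation; the log weight is to be
    minus its integral over \<open>{t..\<tau>'}\<close>.\<close>
  define \<psi> where "\<psi> u \<omega> = - ((\<sigma> u)\<^sup>2 / 2) * \<beta> * (\<beta> - 1)
    * (norm (score p1 u (X u \<omega>) - score p2 u (X u \<omega>)))\<^sup>2" for u \<omega>
  have sde: "backward_sde_solution M G W a \<sigma> \<tau> \<tau>' X"
    using sampling eps_choice by simp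
  have "a = (\<lambda>t x. f t x - ((1 - \<beta>) * (\<sigma> t)\<^sup>2) *\<^sub>R score p1 t x - (\<beta> * (\<sigma> t)\<^sup>2) *\<^sub>R score p2 t x)"
    unfolding a_choice by (intro ext) (simp add: scaleR_add_right mult_ac)
  with sde show "backward_sde_solution M G W
      (\<lambda>t x. f t x - ((1 - \<beta>) * (\<sigma> t)\<^sup>2) *\<^sub>R score p1 t x - (\<beta> * (\<sigma> t)\<^sup>2) *\<^sub>R score p2 t x) \<sigma> \<tau> \<tau>' X"
    by simp
  interpret prob_space M
    using sde by (simp add: backward_sde_solution_def backward_brownian_def)
  have X: "\<And>r. r \<in> {\<tau>..\<tau>'} \<Longrightarrow> X r \<in> borel_measurable (G r)"
    "\<And>\<omega>. \<omega> \<in> space M \<Longrightarrow> continuous_on {\<tau>..\<tau>'} (\<lambda>r. X r \<omega>)"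
    using sde by (auto simp: backward_sde_solution_def)
  have \<sigma>cont: "continuous_on ({\<tau>..\<tau>'} \<times> (UNIV :: 'a set)) (\<lambda>x. \<sigma> (fst x))"
    by (rule continuous_on_compose2[OF sigma_cont]) (auto intro!: continuous_on_fst continuous_on_id)
  have f: "continuous_on ({\<tau>..\<tau>'} \<times> UNIV) (\<lambda>x. f (fst x) (snd x))"
    using f_smooth by (simp add: smooth_drift_def case_prod_unfold)
  have s: "continuous_on ({\<tau>..\<tau>'} \<times> UNIV) (\<lambda>x. score p1 (fst x) (snd x))"
    "continuous_on ({\<tau>..\<tau>'} \<times> UNIV) (\<lambda>x. score p2 (fst x) (snd x))"
    using p_smooth by (auto simp: smooth_log_density_def case_prod_unfold)
  have acont: "continuous_on ({\<tau>..\<tau>'} \<times> UNIV) (\<lambda>(r, x). a r x)"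
    unfolding a_choice case_prod_unfold using \<sigma>cont f s by (intro continuous_intros)
  have \<psi>cont: "continuous_on {\<tau>..\<tau>'} (\<lambda>u. \<psi> u \<omega>)" if "\<omega> \<in> space M" for \<omega>
  proof -
    have "continuous_on {\<tau>..\<tau>'} (\<lambda>u. score p1 u (X u \<omega>))" "continuous_on {\<tau>..\<tau>'} (\<lambda>u. score p2 u (X u \<omega>))"
      using p_smooth X(2)[OF that] by (auto simp: smooth_log_density_def intro: continuous_on_along_path)
    then show ?thesis
      unfolding \<psi>_def using sigma_cont by (intro continuous_intros) auto
  qed
  define \<nu> where "\<nu> p u x = reversal_drift f \<sigma> p u x" for p :: "real \<Rightarrow> 'a \<Rightarrow> real" and u x
  have exists: "\<exists>I. has_backward_integral M (\<bullet>) (\<lambda>u \<omega>. (1 / (\<sigma> u)\<^sup>2) *\<^sub>R \<nu> p u (X u \<omega>)) X t \<tau>' I"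
    if p: "smooth_log_density \<tau> \<tau>' p" and t: "t \<in> {\<tau>..\<tau>'}" for p t
  proof -
    let ?h = "\<lambda>u x. (1 / (\<sigma> u)\<^sup>2) *\<^sub>R \<nu> p u x"
    have sp: "continuous_on ({\<tau>..\<tau>'} \<times> UNIV) (\<lambda>x. score p (fst x) (snd x))"
      using p by (simp add: smooth_log_density_def case_prod_unfold)
    have h: "continuous_on ({\<tau>..\<tau>'} \<times> UNIV) (\<lambda>(r, x). ?h r x)"
      unfolding \<nu>_def reversal_drift_def case_prod_unfold using \<sigma>cont f sp sigma_pos
      by (intro continuous_intros) force+
    have sub: "{t..\<tau>'} \<subseteq> {\<tau>..\<tau>'}"
      using t by auto
    show ?thesis
    proof (rule backward_sde_integral_exists)
      show "backward_sde_solution M G W a \<sigma> t \<tau>' X"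
        by (rule backward_sde_solution_subinterval[OF sde]) (use t in simp)
      show "continuous_on ({t..\<tau>'} \<times> UNIV) (\<lambda>(r, x). a r x)"
        by (rule continuous_on_subset[OF acont]) (use t in auto)
      show "continuous_on {t..\<tau>'} \<sigma>"
        by (rule continuous_on_subset[OF sigma_cont sub])
      show "(\<lambda>\<omega>. ?h r (X r \<omega>)) \<in> borel_measurable (G r)" if "r \<in> {t..\<tau>'}" for r
        using borel_measurable_continuous_on[OF continuous_on_section[OF h] X(1)] that sub by blast
      show "continuous_on {t..\<tau>'} (\<lambda>r. ?h r (X r \<omega>))" if "\<omega> \<in> space M" for \<omega>
        by (rule continuous_on_along_path[OF h continuous_on_subset[OF X(2)[OF that] sub] sub])
    qed (use t in simp)
  qed
  \<comment> \<open>The coefficients \<open>1 - \<beta>\<close> and \<beta> sum to 1, so the common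
    drift \<open>f\<close> is reproduced and only the scores are mixed.\<close>
  have a_eq: "a = (\<lambda>u x. (1 - \<beta>) *\<^sub>R \<nu> p1 u x + \<beta> *\<^sub>R \<nu> p2 u x)"
    unfolding a_choice \<nu>_def reversal_drift_def by (intro ext) (simp add: algebra_simps)
  have log_weight: "AE \<omega> in M. ln (w t \<omega>) = - integral {t..\<tau>'} (\<lambda>u. \<psi> u \<omega>)" if t: "t \<in> {\<tau>..\<tau>'}" for t
  proof -
    let ?g = "\<lambda>q u \<omega>. (1 / (\<sigma> u)\<^sup>2) *\<^sub>R q u (X u \<omega>)"
    let ?E = "\<lambda>q \<omega> u. 1 / (\<sigma> u)\<^sup>2 * ((norm (f u (X u \<omega>)))\<^sup>2 - (norm (q u (X u \<omega>)))\<^sup>2)"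
    let ?B = "\<lambda>q. backward_integral M (?g q) X t \<tau>'"
    let ?F = "forward_integral M (?g f) X t \<tau>'"
    have "?g a = (\<lambda>u \<omega>. (1 - \<beta>) *\<^sub>R ?g (\<nu> p1) u \<omega> + \<beta> *\<^sub>R ?g (\<nu> p2) u \<omega>)"
      unfolding a_eq by (intro ext) (simp add: scaleR_add_right mult_ac)
    moreover have "AE \<omega> in M. backward_integral M (\<lambda>u \<omega>. (1 - \<beta>) *\<^sub>R ?g (\<nu> p1) u \<omega> + \<beta> *\<^sub>R ?g (\<nu> p2) u \<omega>) X t \<tau>' \<omega>
        = (1 - \<beta>) * ?B (\<nu> p1) \<omega> + \<beta> * ?B (\<nu> p2) \<omega>"
      by (rule backward_integral_linear[OF finite_measure_axioms])
        (use t exists[OF p_smooth(1)] exists[OF p_smooth(2)] in auto)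
    ultimately have "AE \<omega> in M. ?B a \<omega> = (1 - \<beta>) * ?B (\<nu> p1) \<omega> + \<beta> * ?B (\<nu> p2) \<omega>"
      by simp
    then show ?thesis
      using AE_space
    proof eventually_elim
      case (elim \<omega>)
      have sub: "{t..\<tau>'} \<subseteq> {\<tau>..\<tau>'}"
        using t by auto
      have int: "(?E q \<omega> has_integral integral {t..\<tau>'} (?E q \<omega>)) {t..\<tau>'}"
        if "continuous_on ({\<tau>..\<tau>'} \<times> UNIV) (\<lambda>(u, x). q u x)" for q
      proof (rule integrable_integral, rule integrable_continuous_real)
        have "continuous_on {t..\<tau>'} (\<lambda>u. q u (X u \<omega>))" "continuous_on {t..\<tau>'} (\<lambda>u. f u (X u \<omega>))"
          using that f_smooth continuous_on_subset[OF X(2)[OF elim(2)] sub] sub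
          by (auto simp: smooth_drift_def intro: continuous_on_along_path)
        moreover have "\<forall>u\<in>{t..\<tau>'}. (\<sigma> u)\<^sup>2 \<noteq> 0"
          using sigma_pos sub by (metis less_irrefl power_eq_0_iff subsetD)
        ultimately show "continuous_on {t..\<tau>'} (?E q \<omega>)"
          using continuous_on_subset[OF sigma_cont sub] by (intro continuous_intros)
      qed
      have \<nu>cont: "continuous_on ({\<tau>..\<tau>'} \<times> UNIV) (\<lambda>(u, x). \<nu> p1 u x)"
        "continuous_on ({\<tau>..\<tau>'} \<times> UNIV) (\<lambda>(u, x). \<nu> p2 u x)"
        unfolding \<nu>_def reversal_drift_def case_prod_unfold using \<sigma>cont f s by (auto intro!: continuous_intros)
      have "((\<lambda>u. (1 - \<beta>) * (1/2 * ?E (\<nu> p1) \<omega> u) + \<beta> * (1/2 * ?E (\<nu> p2) \<omega> u) - 1/2 * ?E a \<omega> u) has_integral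
          (1 - \<beta>) * (1/2 * integral {t..\<tau>'} (?E (\<nu> p1) \<omega>)) + \<beta> * (1/2 * integral {t..\<tau>'} (?E (\<nu> p2) \<omega>))
            - 1/2 * integral {t..\<tau>'} (?E a \<omega>)) {t..\<tau>'}"
        by (intro has_integral_diff has_integral_add has_integral_mult_right int \<nu>cont acont)
      \<comment> \<open>With \<open>c\<close> the squared noise level,
        \<open>guidance_energy\<close> returns the negative of \<psi>.\<close>
      moreover have "(1 - \<beta>) * (1/2 * ?E (\<nu> p1) \<omega> u) + \<beta> * (1/2 * ?E (\<nu> p2) \<omega> u) - 1/2 * ?E a \<omega> u = - \<psi> u \<omega>"
        if "u \<in> {t..\<tau>'}" for u
      proof -
        have "(\<sigma> u)\<^sup>2 \<noteq> 0"
          using sigma_pos[of u] that sub by auto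
        from guidance_energy[OF this, of \<beta> "f u (X u \<omega>)" "score p1 u (X u \<omega>)" "score p2 u (X u \<omega>)"]
        show ?thesis
          unfolding a_choice \<nu>_def reversal_drift_def \<psi>_def by simp
      qed
      ultimately have "((\<lambda>u. - \<psi> u \<omega>) has_integral
          (1 - \<beta>) * (1/2 * integral {t..\<tau>'} (?E (\<nu> p1) \<omega>)) + \<beta> * (1/2 * integral {t..\<tau>'} (?E (\<nu> p2) \<omega>))
            - 1/2 * integral {t..\<tau>'} (?E a \<omega>)) {t..\<tau>'}"
        by (rule has_integral_eq[rotated])
      then have energy: "(1 - \<beta>) * (1/2 * integral {t..\<tau>'} (?E (\<nu> p1) \<omega>)) + \<beta> * (1/2 * integral {t..\<tau>'} (?E (\<nu> p2) \<omega>))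
            - 1/2 * integral {t..\<tau>'} (?E a \<omega>) = - integral {t..\<tau>'} (\<lambda>u. \<psi> u \<omega>)"
        unfolding integral_neg[symmetric] by (rule integral_unique[symmetric])
      have powr: "exp x powr c * exp y powr d * inverse (exp z) = exp (c * x + d * y - z)" for c d x y z :: real
        by (simp add: powr_def exp_add exp_diff divide_inverse)
      \<comment> \<open>The same function \<open>?F\<close> enters all three exponents and drops out
        for every \<omega>; the backward integrals drop out where \<open>elim(1)\<close>
        holds.\<close>
      let ?R = "\<lambda>q. ?B q \<omega> - ?F \<omega> + 1/2 * integral {t..\<tau>'} (?E q \<omega>)"
      have "w t \<omega> = exp (?R (\<nu> p1)) powr (1 - \<beta>) * exp (?R (\<nu> p2)) powr \<beta> * inverse (exp (?R a))"
        unfolding weight cfg_weight_def rn_ratio_def eps_choice b_choice \<nu>_def ..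
      also have "\<dots> = exp ((1 - \<beta>) * ?R (\<nu> p1) + \<beta> * ?R (\<nu> p2) - ?R a)"
        by (rule powr)
      finally have "ln (w t \<omega>) = (1 - \<beta>) * ?R (\<nu> p1) + \<beta> * ?R (\<nu> p2) - ?R a"
        by simp
      also have "\<dots> = (1 - \<beta>) * (1/2 * integral {t..\<tau>'} (?E (\<nu> p1) \<omega>)) + \<beta> * (1/2 * integral {t..\<tau>'} (?E (\<nu> p2) \<omega>))
            - 1/2 * integral {t..\<tau>'} (?E a \<omega>)"
        unfolding elim(1) by (simp add: algebra_simps)
      finally show ?case
        using energy by simp
    qed
  qed
  show "\<forall>t\<in>{\<tau>..\<tau>'}. AE \<omega> in M.
      ln (w t \<omega>) = - integral {t..\<tau>'} (\<lambda>u. - ((\<sigma> u)\<^sup>2 / 2) * \<beta> * (\<beta> - 1)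
                            * (norm (score p1 u (X u \<omega>) - score p2 u (X u \<omega>)))\<^sup>2)"
    using log_weight unfolding \<psi>_def by blast
  show "\<exists>L. (\<forall>t\<in>{\<tau>..\<tau>'}. AE \<omega> in M. L t \<omega> = ln (w t \<omega>))
            \<and> (AE \<omega> in M. L \<tau>' \<omega> = 0
                \<and> (\<forall>t\<in>{\<tau>..\<tau>'}. ((\<lambda>u. L u \<omega>) has_real_derivative
                     - ((\<sigma> t)\<^sup>2 / 2) * \<beta> * (\<beta> - 1)
                       * (norm (score p1 t (X t \<omega>) - score p2 t (X t \<omega>)))\<^sup>2)
                     (at t within {\<tau>..\<tau>'})))"
  proof (intro exI conjI ballI)
    \<comment> \<open>The witness is the time integral itself: it equals \<open>ln (w t)\<close>
      almost surely for each \<open>t\<close>, and it is differentiable along every path.\<close>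
    show "AE \<omega> in M. - integral {t..\<tau>'} (\<lambda>u. \<psi> u \<omega>) = ln (w t \<omega>)" if "t \<in> {\<tau>..\<tau>'}" for t
      using log_weight[OF that] by eventually_elim simp
    \<comment> \<open>Differentiation in the lower limit brings a minus sign, which cancels the one
      in front; continuity of \<psi> along the path makes the derivative exist at every
      time.\<close>
    have "((\<lambda>u. - integral {u..\<tau>'} (\<lambda>u. \<psi> u \<omega>)) has_real_derivative \<psi> t \<omega>) (at t within {\<tau>..\<tau>'})"
      if "\<omega> \<in> space M" "t \<in> {\<tau>..\<tau>'}" for \<omega> t
      using DERIV_minus[OF integral_has_real_derivative'[OF \<psi>cont[OF that(1)] that(2)]] by simp
    then show "AE \<omega> in M. - integral {\<tau>'..\<tau>'} (\<lambda>u. \<psi> u \<omega>) = 0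
        \<and> (\<forall>t\<in>{\<tau>..\<tau>'}. ((\<lambda>u. - integral {u..\<tau>'} (\<lambda>u. \<psi> u \<omega>)) has_real_derivative
             - ((\<sigma> t)\<^sup>2 / 2) * \<beta> * (\<beta> - 1) * (norm (score p1 t (X t \<omega>) - score p2 t (X t \<omega>)))\<^sup>2)
           (at t within {\<tau>..\<tau>'}))"
      unfolding \<psi>_def by (intro AE_I2) auto
  qed
qed

end
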